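(* Let $(M,g)$ be a Kähler manifold, let $p\in M$, let $0<\rho\le\infty$, and let $\iota\colon\{z\in\mathbb{C}:|z|^2<\rho\}\to M$ be a holomorphic embedding of a disc with $\iota(0)=p$ such that $\iota^*g$ has a Kähler potential of the form $\varphi(|z|^2)$, where $\varphi(0)=0$ and $\varphi$ is real analytic on $[0,\rho)$, that is, $\varphi$ extends holomorphically to a complex neighbourhood of $[0,\rho)$. If the Taylor series of $X\mapsto e^{\varphi(X)}$ at $X=0$ has radius of convergence $r<\rho$, then no neighbourhood of $p$ in $M$ admits a Kähler immersion into $(\mathbb{CP}^N,g_{\mathrm{FS}})$ for any $N\le\infty$. In particular, $g$ is not projectively induced.
   Context: A Kähler immersion is a holomorphic isometric immersion: a holomorphic map $F$ with $F^*g_{\mathrm{FS}}$ equal to the given metric. A Kähler metric $g$ on $M$ is projectively induced if $(M,g)$ admits a Kähler immersion into $(\mathbb{CP}^N,g_{\mathrm{FS}})$ for some $N\le\infty$. $\mathbb{CP}^N$ with $N\le\infty$ is the finite- or infinite-dimensional complex projective space ($\mathbb{CP}^\infty$ being the projectivization of the Hilbert space $\ell^2(\mathbb{C})$), and $g_{\mathrm{FS}}$ is the Fubini--Study metric, normalized so that in the affine chart $Z_0\neq 0$ with coordinates $w_j=Z_j/Z_0$ its Kähler form is $\frac{i}{2}\partial\bar\partial\log(1+\sum_j|w_j|^2)$. A Kähler potential of a metric is a real function $\Phi$ such that the Kähler form is $\frac{i}{2}\partial\bar\partial\Phi$. *)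

theory Defs
  imports "HOL-Complex_Analysis.Complex_Analysis" "HOL-Library.Extended_Nat"
begin

section \<open>Complex normed vector spaces\<close>

class complex_normed_vector = real_normed_vector +
  fixes scaleC :: "complex \<Rightarrow> 'a \<Rightarrow> 'a" (infixr \<open>*\<^sub>C\<close> 75)
  assumes scaleC_add_right: "c *\<^sub>C (x + y) = c *\<^sub>C x + c *\<^sub>C y"
    and scaleC_add_left: "(c + d) *\<^sub>C x = c *\<^sub>C x + d *\<^sub>C x"
    and scaleC_scaleC: "c *\<^sub>C (d *\<^sub>C x) = (c * d) *\<^sub>C x"
    and scaleC_of_real: "complex_of_real r *\<^sub>C x = r *\<^sub>R x"
    and norm_scaleC: "norm (c *\<^sub>C x) = cmod c * norm x"

instantiation complex :: complex_normed_vector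
begin

definition scaleC_complex :: "complex \<Rightarrow> complex \<Rightarrow> complex"
  where "scaleC_complex c z = c * z"

instance
  by standard (auto simp: scaleC_complex_def algebra_simps norm_mult scaleR_conv_of_real)

end

instantiation vec :: (complex_normed_vector, finite) complex_normed_vector
begin

definition scaleC_vec :: "complex \<Rightarrow> 'a ^ 'b \<Rightarrow> 'a ^ 'b"
  where "scaleC_vec c v = (\<chi> i. c *\<^sub>C (v $ i))"

instance
proof
  fix c d :: complex and x y :: "'a ^ 'b" and r :: real
  show "c *\<^sub>C (x + y) = c *\<^sub>C x + c *\<^sub>C y"
    by (simp add: scaleC_vec_def vec_eq_iff scaleC_add_right)
  show "(c + d) *\<^sub>C x = c *\<^sub>C x + d *\<^sub>C x"
    by (simp add: scaleC_vec_def vec_eq_iff scaleC_add_left)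
  show "c *\<^sub>C (d *\<^sub>C x) = (c * d) *\<^sub>C x"
    by (simp add: scaleC_vec_def vec_eq_iff scaleC_scaleC)
  show "complex_of_real r *\<^sub>C x = r *\<^sub>R x"
    by (simp add: scaleC_vec_def vec_eq_iff scaleC_of_real)
  show "norm (c *\<^sub>C x) = cmod c * norm x"
    by (simp add: scaleC_vec_def norm_vec_def norm_scaleC L2_set_right_distrib)
qed

end

section \<open>The Hilbert space of square-summable complex sequences\<close>

typedef ell2 = "{f :: nat \<Rightarrow> complex. summable (\<lambda>j. (cmod (f j))\<^sup>2)}"
  morphisms coord Abs_ell2
  by (rule exI[of _ "\<lambda>_. 0"]) simp

lemma summable_coord: "summable (\<lambda>j. (cmod (coord x j))\<^sup>2)"
  using coord[of x] by simp

lemma ell2_eqI: "(\<And>j. coord x j = coord y j) \<Longrightarrow> x = y"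
  using coord_inject by blast

lemma summable_add_sq:
  fixes f g :: "nat \<Rightarrow> complex"
  assumes "summable (\<lambda>j. (cmod (f j))\<^sup>2)" and "summable (\<lambda>j. (cmod (g j))\<^sup>2)"
  shows "summable (\<lambda>j. (cmod (f j + g j))\<^sup>2)"
proof (rule summable_comparison_test')
  show "summable (\<lambda>j. 2 * (cmod (f j))\<^sup>2 + 2 * (cmod (g j))\<^sup>2)"
    using assms by (intro summable_add summable_mult)
  fix j :: nat
  have "(cmod (f j + g j))\<^sup>2 \<le> (cmod (f j) + cmod (g j))\<^sup>2"
    by (intro power_mono norm_triangle_ineq norm_ge_zero)
  also have "\<dots> \<le> 2 * (cmod (f j))\<^sup>2 + 2 * (cmod (g j))\<^sup>2"
    using zero_le_power2[of "cmod (f j) - cmod (g j)"]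
    by (simp add: power2_eq_square algebra_simps)
  finally show "norm ((cmod (f j + g j))\<^sup>2) \<le> 2 * (cmod (f j))\<^sup>2 + 2 * (cmod (g j))\<^sup>2"
    by simp
qed

lemma summable_scale_sq:
  fixes f :: "nat \<Rightarrow> complex"
  assumes "summable (\<lambda>j. (cmod (f j))\<^sup>2)"
  shows "summable (\<lambda>j. (cmod (c * f j))\<^sup>2)"
  using summable_mult[OF assms, of "(cmod c)\<^sup>2"] by (simp add: norm_mult power_mult_distrib)

instantiation ell2 :: real_inner
begin

definition zero_ell2 :: ell2 where "0 = Abs_ell2 (\<lambda>_. 0)"
definition plus_ell2 :: "ell2 \<Rightarrow> ell2 \<Rightarrow> ell2"
  where "x + y = Abs_ell2 (\<lambda>j. coord x j + coord y j)"
definition scaleR_ell2 :: "real \<Rightarrow> ell2 \<Rightarrow> ell2"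
  where "scaleR_ell2 r x = Abs_ell2 (\<lambda>j. complex_of_real r * coord x j)"
definition uminus_ell2 :: "ell2 \<Rightarrow> ell2"
  where "- x = (-1) *\<^sub>R (x :: ell2)"
definition minus_ell2 :: "ell2 \<Rightarrow> ell2 \<Rightarrow> ell2"
  where "x - y = x + - (y :: ell2)"
definition inner_ell2 :: "ell2 \<Rightarrow> ell2 \<Rightarrow> real"
  where "inner_ell2 x y = (\<Sum>j. coord x j \<bullet> coord y j)"
definition norm_ell2 :: "ell2 \<Rightarrow> real"
  where "norm_ell2 x = sqrt (x \<bullet> x)"
definition dist_ell2 :: "ell2 \<Rightarrow> ell2 \<Rightarrow> real"
  where "dist_ell2 x y = norm (x - y)"
definition sgn_ell2 :: "ell2 \<Rightarrow> ell2"
  where "sgn_ell2 x = inverse (norm x) *\<^sub>R x"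
definition uniformity_ell2 :: "(ell2 \<times> ell2) filter"
  where "uniformity_ell2 = (INF e\<in>{0<..}. principal {(x, y). dist x y < e})"
definition open_ell2 :: "ell2 set \<Rightarrow> bool"
  where "open_ell2 U = (\<forall>x\<in>U. eventually (\<lambda>(x', y). x' = x \<longrightarrow> y \<in> U) uniformity)"

lemma coord_zero: "coord 0 j = 0"
  by (simp add: zero_ell2_def Abs_ell2_inverse)

lemma coord_plus: "coord (x + y) j = coord x j + coord y j"
  by (simp add: plus_ell2_def Abs_ell2_inverse summable_add_sq summable_coord)

lemma coord_scaleR: "coord (r *\<^sub>R x) j = complex_of_real r * coord x j"
  by (simp add: scaleR_ell2_def Abs_ell2_inverse summable_scale_sq summable_coord)

lemma coord_uminus: "coord (- x) j = - coord x j"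
  by (simp add: uminus_ell2_def coord_scaleR)

lemma coord_minus: "coord (x - y) j = coord x j - coord y j"
  by (simp add: minus_ell2_def coord_plus coord_uminus)

lemma summable_inner: "summable (\<lambda>j. coord x j \<bullet> coord y j)"
proof (rule summable_comparison_test')
  show "summable (\<lambda>j. (cmod (coord x j))\<^sup>2 + (cmod (coord y j))\<^sup>2)"
    by (intro summable_add summable_coord)
  fix j :: nat
  have "norm (coord x j \<bullet> coord y j) \<le> cmod (coord x j) * cmod (coord y j)"
    using Cauchy_Schwarz_ineq2 by simp
  also have "\<dots> \<le> (cmod (coord x j))\<^sup>2 + (cmod (coord y j))\<^sup>2"
    using sum_squares_bound[of "cmod (coord x j)" "cmod (coord y j)"]
      mult_nonneg_nonneg[OF norm_ge_zero norm_ge_zero, of "coord x j" "coord y j"]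
    by linarith
  finally show "norm (coord x j \<bullet> coord y j) \<le> (cmod (coord x j))\<^sup>2 + (cmod (coord y j))\<^sup>2" .
qed

instance
proof
  fix x y z :: ell2 and a b :: real and U :: "ell2 set"
  show "x + y + z = x + (y + z)" by (rule ell2_eqI) (simp add: coord_plus)
  show "x + y = y + x" by (rule ell2_eqI) (simp add: coord_plus)
  show "0 + x = x" by (rule ell2_eqI) (simp add: coord_plus coord_zero)
  show "- x + x = 0" by (rule ell2_eqI) (simp add: coord_plus coord_uminus coord_zero)
  show "x - y = x + - y" by (rule minus_ell2_def)
  show "a *\<^sub>R (x + y) = a *\<^sub>R x + a *\<^sub>R y"
    by (rule ell2_eqI) (simp add: coord_plus coord_scaleR algebra_simps)
  show "(a + b) *\<^sub>R x = a *\<^sub>R x + b *\<^sub>R x"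
    by (rule ell2_eqI) (simp add: coord_plus coord_scaleR algebra_simps)
  show "a *\<^sub>R b *\<^sub>R x = (a * b) *\<^sub>R x" by (rule ell2_eqI) (simp add: coord_scaleR)
  show "1 *\<^sub>R x = x" by (rule ell2_eqI) (simp add: coord_scaleR)
  show "dist x y = norm (x - y)" by (rule dist_ell2_def)
  show "sgn x = inverse (norm x) *\<^sub>R x" by (rule sgn_ell2_def)
  show "uniformity = (INF e\<in>{0<..}. principal {(x, y :: ell2). dist x y < e})"
    by (rule uniformity_ell2_def)
  show "open U = (\<forall>x\<in>U. \<forall>\<^sub>F (x', y) in uniformity. x' = x \<longrightarrow> y \<in> U)"
    by (rule open_ell2_def)
  show "norm x = sqrt (x \<bullet> x)" by (rule norm_ell2_def)
  show "x \<bullet> y = y \<bullet> x" by (simp add: inner_ell2_def inner_commute)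
  show "(x + y) \<bullet> z = x \<bullet> z + y \<bullet> z"
    by (simp add: inner_ell2_def coord_plus inner_add_left suminf_add summable_inner)
  have "coord (a *\<^sub>R x) j \<bullet> coord y j = a * (coord x j \<bullet> coord y j)" for j
    by (simp add: coord_scaleR flip: scaleR_conv_of_real)
  then show "a *\<^sub>R x \<bullet> y = a * (x \<bullet> y)"
    by (simp add: inner_ell2_def suminf_mult summable_inner)
  show "0 \<le> x \<bullet> x" by (simp add: inner_ell2_def suminf_nonneg summable_inner)
  have "x \<bullet> x = 0 \<longleftrightarrow> (\<forall>j. coord x j \<bullet> coord x j = 0)"
    unfolding inner_ell2_def by (rule suminf_eq_zero_iff) (auto simp: summable_inner)
  also have "\<dots> \<longleftrightarrow> x = 0" by (auto intro: ell2_eqI simp: coord_zero)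
  finally show "x \<bullet> x = 0 \<longleftrightarrow> x = 0" .
qed

end

instantiation ell2 :: complex_normed_vector
begin

definition scaleC_ell2 :: "complex \<Rightarrow> ell2 \<Rightarrow> ell2"
  where "scaleC_ell2 c x = Abs_ell2 (\<lambda>j. c * coord x j)"

lemma coord_scaleC: "coord (c *\<^sub>C x) j = c * coord x j"
  by (simp add: scaleC_ell2_def Abs_ell2_inverse summable_scale_sq summable_coord)

lemma norm_ell2_sq: "(norm (x :: ell2))\<^sup>2 = (\<Sum>j. (cmod (coord x j))\<^sup>2)"
  by (simp add: power2_norm_eq_inner) (simp add: inner_ell2_def)

instance
proof
  fix c d :: complex and x y :: ell2 and r :: real
  show "c *\<^sub>C (x + y) = c *\<^sub>C x + c *\<^sub>C y"
    by (rule ell2_eqI) (simp add: coord_plus coord_scaleC algebra_simps)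
  show "(c + d) *\<^sub>C x = c *\<^sub>C x + d *\<^sub>C x"
    by (rule ell2_eqI) (simp add: coord_plus coord_scaleC algebra_simps)
  show "c *\<^sub>C (d *\<^sub>C x) = (c * d) *\<^sub>C x" by (rule ell2_eqI) (simp add: coord_scaleC)
  show "complex_of_real r *\<^sub>C x = r *\<^sub>R x"
    by (rule ell2_eqI) (simp add: coord_scaleC coord_scaleR)
  have "(norm (c *\<^sub>C x))\<^sup>2 = (cmod c * norm x)\<^sup>2"
    by (simp add: norm_ell2_sq coord_scaleC norm_mult power_mult_distrib suminf_mult summable_coord)
  then show "norm (c *\<^sub>C x) = cmod c * norm x" by (simp add: power2_eq_iff_nonneg)
qed

end

section \<open>Calculus on complex normed vector spaces\<close>

definition holo_on :: "'a::complex_normed_vector set \<Rightarrow> ('a \<Rightarrow> 'b::complex_normed_vector) \<Rightarrow> bool"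
  where "holo_on S f \<longleftrightarrow>
    (\<forall>x\<in>S. \<exists>D. (f has_derivative D) (at x) \<and> (\<forall>c v. D (c *\<^sub>C v) = c *\<^sub>C D v))"

primrec Ck_on :: "nat \<Rightarrow> 'a::real_normed_vector set \<Rightarrow> ('a \<Rightarrow> 'b::real_normed_vector) \<Rightarrow> bool"
  where
    "Ck_on 0 S f \<longleftrightarrow> continuous_on S f"
  | "Ck_on (Suc k) S f \<longleftrightarrow>
      f differentiable_on S \<and> (\<forall>v. Ck_on k S (\<lambda>x. frechet_derivative f (at x) v))"

text \<open>Only used for open subsets of finite-dimensional spaces.\<close>
definition smooth_on :: "'a::real_normed_vector set \<Rightarrow> ('a \<Rightarrow> 'b::real_normed_vector) \<Rightarrow> bool"
  where "smooth_on S f \<longleftrightarrow> (\<forall>k. Ck_on k S f)"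

text \<open>In coordinates, \<open>del u f\<close> is the sum of \<open>u\<^sub>j \<partial>f/\<partial>z\<^sub>j\<close>, and \<open>delbar u f\<close> is the sum of
  \<open>cnj u\<^sub>j \<partial>f/\<partial>cnj z\<^sub>j\<close>.\<close>
definition del :: "'a::complex_normed_vector \<Rightarrow> ('a \<Rightarrow> complex) \<Rightarrow> 'a \<Rightarrow> complex"
  where "del u f x =
    (frechet_derivative f (at x) u - \<i> * frechet_derivative f (at x) (\<i> *\<^sub>C u)) / 2"

definition delbar :: "'a::complex_normed_vector \<Rightarrow> ('a \<Rightarrow> complex) \<Rightarrow> 'a \<Rightarrow> complex"
  where "delbar u f x =
    (frechet_derivative f (at x) u + \<i> * frechet_derivative f (at x) (\<i> *\<^sub>C u)) / 2"

text \<open>The value on the pair \<open>(u, v)\<close> of the 2-form \<open>\<partial>\<partial>\<close>-bar \<open>\<Phi>\<close>, that is, of the sum of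
  \<open>\<partial>\<^sup>2\<Phi>/\<partial>z\<^sub>j\<partial>cnj z\<^sub>k dz\<^sub>j \<and> d(cnj z\<^sub>k)\<close>, where
  \<open>(dz\<^sub>j \<and> d(cnj z\<^sub>k)) (u, v) = u\<^sub>j cnj v\<^sub>k - v\<^sub>j cnj u\<^sub>k\<close>.\<close>
definition ddbar :: "('a::complex_normed_vector \<Rightarrow> real) \<Rightarrow> 'a \<Rightarrow> 'a \<Rightarrow> 'a \<Rightarrow> complex"
  where "ddbar \<Phi> x u v =
    del u (delbar v (\<lambda>y. complex_of_real (\<Phi> y))) x
    - del v (delbar u (\<lambda>y. complex_of_real (\<Phi> y))) x"

section \<open>Complex manifolds and Kaehler metrics\<close>

type_synonym ('m, 'e) chart = "'m set \<times> ('m \<Rightarrow> 'e)"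

record ('m, 'e) cmanifold =
  mtop :: "'m topology"
  atlas :: "('m, 'e) chart set"

abbreviation chart_inv :: "('m, 'e) chart \<Rightarrow> 'e \<Rightarrow> 'm"
  where "chart_inv C \<equiv> inv_into (fst C) (snd C)"

definition local_rep ::
    "('m, 'e) chart \<Rightarrow> ('k, 'f) chart \<Rightarrow> ('m \<Rightarrow> 'k) \<Rightarrow> 'e \<Rightarrow> 'f"
  where "local_rep C D F = snd D \<circ> F \<circ> chart_inv C"

definition complex_manifold :: "('m, 'e::complex_normed_vector) cmanifold \<Rightarrow> bool"
  where "complex_manifold M \<longleftrightarrow>
    Hausdorff_space (mtop M) \<and> second_countable (mtop M) \<and>
    (\<Union>C\<in>atlas M. fst C) = topspace (mtop M) \<and>
    (\<forall>C\<in>atlas M. openin (mtop M) (fst C) \<and> open (snd C ` fst C) \<and>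
      homeomorphic_map (subtopology (mtop M) (fst C)) (top_of_set (snd C ` fst C)) (snd C)) \<and>
    (\<forall>C\<in>atlas M. \<forall>D\<in>atlas M. holo_on (snd C ` (fst C \<inter> fst D)) (local_rep C D id))"

definition holomorphic_map ::
    "('m, 'e::complex_normed_vector) cmanifold \<Rightarrow> ('k, 'f::complex_normed_vector) cmanifold \<Rightarrow>
     'm set \<Rightarrow> ('m \<Rightarrow> 'k) \<Rightarrow> bool"
  where "holomorphic_map M N W F \<longleftrightarrow>
    continuous_map (subtopology (mtop M) W) (mtop N) F \<and>
    (\<forall>C\<in>atlas M. \<forall>D\<in>atlas N.
      holo_on (snd C ` {p \<in> fst C \<inter> W. F p \<in> fst D}) (local_rep C D F))"

definition holomorphic_embedding ::
    "('m, 'e::complex_normed_vector) cmanifold \<Rightarrow> ('k, 'f::complex_normed_vector) cmanifold \<Rightarrow>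
     ('m \<Rightarrow> 'k) \<Rightarrow> bool"
  where "holomorphic_embedding M N F \<longleftrightarrow>
    holomorphic_map M N (topspace (mtop M)) F \<and> embedding_map (mtop M) (mtop N) F \<and>
    (\<forall>C\<in>atlas M. \<forall>D\<in>atlas N. \<forall>p\<in>fst C. F p \<in> fst D \<longrightarrow>
      inj (frechet_derivative (local_rep C D F) (at (snd C p))))"

text \<open>A field of bilinear forms on the tangent spaces is given by its coordinate expressions:
  \<open>g C p u v\<close> is the value at \<open>p\<close> on the tangent vectors whose components in the chart \<open>C\<close>
  are \<open>u\<close> and \<open>v\<close>.\<close>
type_synonym ('m, 'e) metric = "('m, 'e) chart \<Rightarrow> 'm \<Rightarrow> 'e \<Rightarrow> 'e \<Rightarrow> real"

text \<open>\<open>h\<close> is, over \<open>W\<close>, the pullback of \<open>g\<close> along \<open>F\<close>.\<close>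
definition is_pullback ::
    "('m, 'e::complex_normed_vector) cmanifold \<Rightarrow> ('k, 'f::complex_normed_vector) cmanifold \<Rightarrow>
     'm set \<Rightarrow> ('m \<Rightarrow> 'k) \<Rightarrow> ('k, 'f) metric \<Rightarrow> ('m, 'e) metric \<Rightarrow> bool"
  where "is_pullback M N W F g h \<longleftrightarrow>
    (\<forall>C\<in>atlas M. \<forall>D\<in>atlas N. \<forall>p \<in> fst C \<inter> W. F p \<in> fst D \<longrightarrow>
      (\<forall>u v. h C p u v =
        g D (F p) (frechet_derivative (local_rep C D F) (at (snd C p)) u)
                  (frechet_derivative (local_rep C D F) (at (snd C p)) v)))"

text \<open>The convention is \<open>\<omega>(u, v) = g(Ju, v)\<close>, so that the Euclidean metric of the plane has
  the Kaehler form \<open>dx \<and> dy = (i/2) dz \<and> d(cnj z)\<close>.\<close>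
definition kahler_form :: "('m, 'e::complex_normed_vector) metric \<Rightarrow> ('m, 'e) metric"
  where "kahler_form g C p u v = g C p (\<i> *\<^sub>C u) v"

text \<open>The last conjunct is closedness of the Kaehler form: the exterior derivative evaluated
  on three coordinate vector fields.\<close>
definition kahler_metric ::
    "('m, 'e::complex_normed_vector) cmanifold \<Rightarrow> ('m, 'e) metric \<Rightarrow> bool"
  where "kahler_metric M g \<longleftrightarrow>
    is_pullback M M (topspace (mtop M)) id g g \<and>
    (\<forall>C\<in>atlas M. \<forall>p\<in>fst C.
      bounded_bilinear (g C p) \<and>
      (\<forall>u v. g C p u v = g C p v u) \<and>
      (\<forall>u. u \<noteq> 0 \<longrightarrow> g C p u u > 0) \<and>
      (\<forall>u v. g C p (\<i> *\<^sub>C u) (\<i> *\<^sub>C v) = g C p u v)) \<and>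
    (\<forall>C\<in>atlas M. \<forall>u v. smooth_on (snd C ` fst C) (\<lambda>x. g C (chart_inv C x) u v)) \<and>
    (\<forall>C\<in>atlas M. \<forall>x\<in>snd C ` fst C. \<forall>u v w.
      frechet_derivative (\<lambda>y. kahler_form g C (chart_inv C y) v w) (at x) u +
      frechet_derivative (\<lambda>y. kahler_form g C (chart_inv C y) w u) (at x) v +
      frechet_derivative (\<lambda>y. kahler_form g C (chart_inv C y) u v) (at x) w = 0)"

definition kahler_manifold ::
    "('m, 'e::complex_normed_vector) cmanifold \<Rightarrow> ('m, 'e) metric \<Rightarrow> bool"
  where "kahler_manifold M g \<longleftrightarrow> complex_manifold M \<and> kahler_metric M g"

definition kahler_potential ::
    "('m, 'e::complex_normed_vector) cmanifold \<Rightarrow> ('m, 'e) metric \<Rightarrow> ('m \<Rightarrow> real) \<Rightarrow> bool"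
  where "kahler_potential M g \<Phi> \<longleftrightarrow>
    (\<forall>C\<in>atlas M. smooth_on (snd C ` fst C) (\<Phi> \<circ> chart_inv C) \<and>
      (\<forall>p\<in>fst C. \<forall>u v. complex_of_real (kahler_form g C p u v) =
        \<i> / 2 * ddbar (\<Phi> \<circ> chart_inv C) (snd C p) u v))"

definition kahler_immersion ::
    "('m, 'e::complex_normed_vector) cmanifold \<Rightarrow> ('m, 'e) metric \<Rightarrow>
     ('k, 'f::complex_normed_vector) cmanifold \<Rightarrow> ('k, 'f) metric \<Rightarrow>
     'm set \<Rightarrow> ('m \<Rightarrow> 'k) \<Rightarrow> bool"
  where "kahler_immersion M g N h W F \<longleftrightarrow> holomorphic_map M N W F \<and> is_pullback M N W F h g"

text \<open>The disc where the squared modulus is less than \<open>\<rho>\<close>; it is the plane for \<open>\<rho> = \<infinity>\<close>.\<close>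
definition disc :: "ereal \<Rightarrow> complex set"
  where "disc \<rho> = {z. ereal ((cmod z)\<^sup>2) < \<rho>}"

definition disc_manifold :: "ereal \<Rightarrow> (complex, complex) cmanifold"
  where "disc_manifold \<rho> = \<lparr>mtop = top_of_set (disc \<rho>), atlas = {(disc \<rho>, id)}\<rparr>"

section \<open>Projective spaces of finite and infinite dimension\<close>

text \<open>The sequences \<open>(Z\<^sub>0, \<dots>, Z\<^sub>N, 0, 0, \<dots>)\<close> when \<open>N\<close> is finite, all of \<open>ell2\<close> when \<open>N = \<infinity>\<close>.\<close>
definition hom_coords :: "enat \<Rightarrow> ell2 set"
  where "hom_coords N = {Z. \<forall>j. N < enat j \<longrightarrow> coord Z j = 0}"

definition cline :: "ell2 \<Rightarrow> ell2 set"
  where "cline Z = range (\<lambda>c. c *\<^sub>C Z)"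

text \<open>The quotient topology on the set of complex lines.\<close>
definition proj_topology :: "enat \<Rightarrow> ell2 set topology"
  where "proj_topology N = topology (\<lambda>W. W \<subseteq> cline ` (hom_coords N - {0}) \<and>
    openin (top_of_set (hom_coords N - {0})) {Z \<in> hom_coords N - {0}. cline Z \<in> W})"

lemma openin_proj_topology:
  "openin (proj_topology N) W \<longleftrightarrow> W \<subseteq> cline ` (hom_coords N - {0}) \<and>
    openin (top_of_set (hom_coords N - {0})) {Z \<in> hom_coords N - {0}. cline Z \<in> W}"
proof -
  let ?V = "hom_coords N - {0}"
  have "istopology (\<lambda>W. W \<subseteq> cline ` ?V \<and> openin (top_of_set ?V) {Z \<in> ?V. cline Z \<in> W})"
    unfolding istopology_def
  proof (intro conjI allI impI; (elim conjE)?)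
    fix S T
    assume "openin (top_of_set ?V) {Z \<in> ?V. cline Z \<in> S}"
      and "openin (top_of_set ?V) {Z \<in> ?V. cline Z \<in> T}"
    moreover have "{Z \<in> ?V. cline Z \<in> S \<inter> T} = {Z \<in> ?V. cline Z \<in> S} \<inter> {Z \<in> ?V. cline Z \<in> T}"
      by auto
    ultimately show "openin (top_of_set ?V) {Z \<in> ?V. cline Z \<in> S \<inter> T}"
      by (simp only: openin_Int)
  next
    fix K
    assume K: "\<forall>S\<in>K. S \<subseteq> cline ` ?V \<and> openin (top_of_set ?V) {Z \<in> ?V. cline Z \<in> S}"
    have "{Z \<in> ?V. cline Z \<in> \<Union>K} = (\<Union>S\<in>K. {Z \<in> ?V. cline Z \<in> S})" by auto
    moreover have "openin (top_of_set ?V) (\<Union>S\<in>K. {Z \<in> ?V. cline Z \<in> S})"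
      using K by (intro openin_Union) blast
    ultimately show "openin (top_of_set ?V) {Z \<in> ?V. cline Z \<in> \<Union>K}" by (rule ssubst)
  qed auto
  then show ?thesis by (simp add: proj_topology_def topology_inverse')
qed

text \<open>The coordinates \<open>Z\<^sub>j / Z\<^sub>k\<close> with \<open>j \<noteq> k\<close>, renumbered consecutively from \<open>0\<close>. For
  \<open>N = \<infinity>\<close> they fill \<open>ell2\<close>; for finite \<open>N\<close> they fill the copy of \<open>\<complex>\<^sup>N\<close> in \<open>ell2\<close> on which all
  but the first \<open>N\<close> coordinates vanish.\<close>
definition affine_coords :: "nat \<Rightarrow> ell2 set \<Rightarrow> ell2"
  where "affine_coords k L =
    (let Z = (THE Z. Z \<in> L \<and> coord Z k = 1)
     in Abs_ell2 (\<lambda>j. coord Z (if j < k then j else Suc j)))"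

definition affine_chart :: "enat \<Rightarrow> nat \<Rightarrow> (ell2 set, ell2) chart"
  where "affine_chart N k = (cline ` {Z \<in> hom_coords N. coord Z k \<noteq> 0}, affine_coords k)"

definition proj_space :: "enat \<Rightarrow> (ell2 set, ell2) cmanifold"
  where "proj_space N =
    \<lparr>mtop = proj_topology N, atlas = {affine_chart N k | k. enat k \<le> N}\<rparr>"

lemma affine_coords_cline:
  assumes "coord Z k \<noteq> 0"
  shows "coord (affine_coords k (cline Z)) j = coord Z (if j < k then j else Suc j) / coord Z k"
proof -
  let ?Y = "(1 / coord Z k) *\<^sub>C Z"
  have the: "(THE Y. Y \<in> cline Z \<and> coord Y k = 1) = ?Y"
  proof (rule the_equality)
    show "?Y \<in> cline Z \<and> coord ?Y k = 1"
      using assms by (auto simp: cline_def coord_scaleC)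
  next
    fix Y assume "Y \<in> cline Z \<and> coord Y k = 1"
    then obtain c where "Y = c *\<^sub>C Z" and "c * coord Z k = 1"
      by (auto simp: cline_def coord_scaleC)
    moreover from this(2) have "c = 1 / coord Z k" using assms by (metis eq_divide_eq)
    ultimately show "Y = ?Y" by blast
  qed
  let ?f = "\<lambda>j. (cmod (coord ?Y j))\<^sup>2"
  have "summable (\<lambda>j. ?f (Suc (j + k)))"
    using summable_coord[of ?Y] summable_iff_shift[of ?f "Suc k"] by simp
  then have "summable (\<lambda>j. (cmod (coord ?Y (if j + k < k then j + k else Suc (j + k))))\<^sup>2)"
    by simp
  then have "summable (\<lambda>j. (cmod (coord ?Y (if j < k then j else Suc j)))\<^sup>2)"
    by (subst (asm) summable_iff_shift)
  then show ?thesis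
    by (simp add: affine_coords_def the Abs_ell2_inverse coord_scaleC)
qed

text \<open>The metric with Kaehler form \<open>(i/2) \<partial>\<partial>\<close>-bar \<open>log (1 + |w|\<^sup>2)\<close> in every affine chart, recovered
  from that form by \<open>g(u, v) = \<omega>(u, Jv)\<close>. For finite \<open>N\<close> only tangent vectors in the copy of
  \<open>\<complex>\<^sup>N\<close> matter, and there this is the usual metric of the finite-dimensional space.\<close>
definition fubini_study :: "(ell2 set, ell2) metric"
  where "fubini_study C L u v =
    Re (\<i> / 2 * ddbar (\<lambda>w. ln (1 + (norm w)\<^sup>2)) (snd C L) u (\<i> *\<^sub>C v))"

definition projectively_induced ::
    "('m, 'e::complex_normed_vector) cmanifold \<Rightarrow> ('m, 'e) metric \<Rightarrow> bool"
  where "projectively_induced M g \<longleftrightarrow>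
    (\<exists>N F. kahler_immersion M g (proj_space N) fubini_study (topspace (mtop M)) F)"

end

theory Submission
  imports Defs
begin

text \<open>In an affine chart, an immersion restricted to a small disc around \<open>0\<close> becomes a holomorphic
  function \<open>f\<close> with values in \<open>ell2\<close>, and comparing Kaehler forms makes
  \<open>log (1 + |f|\<^sup>2) - \<phi>(|z|\<^sup>2)\<close> harmonic. Absorbing its holomorphic part turns this into
  \<open>exp (\<phi>(|z|\<^sup>2)) = |G|\<^sup>2 + |F|\<^sup>2\<close> with \<open>G\<close> and \<open>F\<close> holomorphic, so all Taylor coefficients of
  \<open>exp \<circ> \<phi>\<close> at \<open>0\<close> are nonnegative. By Pringsheim's theorem, \<open>r\<close> is then a singular point of
  \<open>exp \<circ> \<phi>\<close>, whereas \<open>\<phi>\<close> is analytic on \<open>[0, \<rho>)\<close>, which contains \<open>r\<close>.\<close>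

section \<open>Power series with nonnegative coefficients\<close>

text \<open>The immersion exists only near \<open>p\<close>, so it constrains nothing but the germ
  of \<open>\<phi>\<close> at 0; what can be carried along all of [0, \<rho>) is the sign of the
  Taylor coefficients. The sign comes from the diagonal: in |G|^2 + |F|^2 the coefficient of z^n
  cnj(z)^n is a sum of squared moduli of Taylor coefficients. Double power series with values in
  \<open>ell2\<close> are avoided by reading this coefficient off through repeated mixed derivatives
  at 0. The price is regularity: \<open>holo_on\<close> provides one complex-linear derivative and
  every round consumes another, so the derivative of a holomorphic map into \<open>ell2\<close> must
  itself be shown differentiable. The affine charts take values in \<open>ell2\<close> for every N,
  so finite and infinite dimension share one computation.\<close>

lemma nonneg_Reals_sum:
  "(\<And>i. i \<in> A \<Longrightarrow> f i \<in> \<real>\<^sub>\<ge>\<^sub>0) \<Longrightarrow> sum f A \<in> (\<real>\<^sub>\<ge>\<^sub>0 :: complex set)"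
  by (induction A rule: infinite_finite_induct) auto

lemma nonneg_Reals_sums:
  fixes f :: "nat \<Rightarrow> complex"
  assumes "f sums s" and "\<And>n. f n \<in> \<real>\<^sub>\<ge>\<^sub>0"
  shows "s \<in> \<real>\<^sub>\<ge>\<^sub>0"
  using assms closed_sequentially[OF closed_nonneg_Reals_complex, of "\<lambda>n. sum f {..<n}" s]
  by (auto simp: sums_def intro: nonneg_Reals_sum)

lemma eval_fps_nonneg_Reals:
  assumes "\<And>n. fps_nth f n \<in> \<real>\<^sub>\<ge>\<^sub>0" and "z \<in> \<real>\<^sub>\<ge>\<^sub>0" and "ereal (cmod z) < fps_conv_radius f"
  shows "eval_fps f z \<in> \<real>\<^sub>\<ge>\<^sub>0"
  using sums_eval_fps[OF assms(3)] by (rule nonneg_Reals_sums) (use assms in auto)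

lemma higher_deriv_eval_fps_nonneg_Reals:
  assumes "\<And>n. fps_nth f n \<in> \<real>\<^sub>\<ge>\<^sub>0" and "z \<in> \<real>\<^sub>\<ge>\<^sub>0" and "ereal (cmod z) < fps_conv_radius f"
  shows "(deriv ^^ k) (eval_fps f) z \<in> \<real>\<^sub>\<ge>\<^sub>0"
  using assms
proof (induction k arbitrary: f)
  case 0
  then show ?case by (simp add: eval_fps_nonneg_Reals)
next
  case (Suc k)
  have "eventually (\<lambda>w. w \<in> eball 0 (fps_conv_radius f)) (nhds z)"
    using Suc.prems by (intro eventually_nhds_in_open) auto
  then have "eventually (\<lambda>w. deriv (eval_fps f) w = eval_fps (fps_deriv f) w) (nhds z)"
    by eventually_elim (auto intro!: eval_fps_deriv[symmetric])
  then have "(deriv ^^ Suc k) (eval_fps f) z = (deriv ^^ k) (eval_fps (fps_deriv f)) z"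
    unfolding funpow_Suc_right o_def by (rule higher_deriv_cong_ev) simp
  moreover have "(deriv ^^ k) (eval_fps (fps_deriv f)) z \<in> \<real>\<^sub>\<ge>\<^sub>0"
  proof (rule Suc.IH)
    show "ereal (cmod z) < fps_conv_radius (fps_deriv f)"
      using Suc.prems(3) fps_conv_radius_deriv[of f] by (rule less_le_trans)
    show "fps_nth (fps_deriv f) n \<in> \<real>\<^sub>\<ge>\<^sub>0" for n
      using Suc.prems(1)[of "n + 1"]
      by (simp add: fps_deriv_nth del: of_nat_Suc of_nat_add)
  qed fact
  ultimately show ?case by simp
qed

text \<open>If \<open>P\<close> is a partial sum of the series, every derivative of \<open>E - P\<close> at a point \<open>t < r\<close> is
  nonnegative. Hence \<open>P(w) \<le> E(w)\<close> at a point \<open>w > r\<close> reached by the Taylor series of \<open>E\<close> at \<open>t\<close>,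
  and the series would converge at \<open>w\<close>.\<close>
theorem pringsheim:
  fixes e :: "complex fps"
  assumes e: "E has_fps_expansion e" and nonneg: "\<And>n. fps_nth e n \<in> \<real>\<^sub>\<ge>\<^sub>0"
    and "open S" and S: "complex_of_real ` {0..r} \<subseteq> S" and holo: "E holomorphic_on S"
  shows "fps_conv_radius e \<noteq> ereal r"
proof
  assume rad: "fps_conv_radius e = ereal r"
  then have "0 < r" using e by (auto simp: has_fps_expansion_def)
  have "compact (complex_of_real ` {0..r})"
    by (intro compact_continuous_image continuous_intros) auto
  then obtain \<epsilon> where "\<epsilon> > 0" and \<epsilon>: "(\<Union>x\<in>complex_of_real ` {0..r}. ball x \<epsilon>) \<subseteq> S"
    using compact_subset_open_imp_ball_epsilon_subset[OF _ \<open>open S\<close> S] by blast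
  \<comment> \<open>Points of the rectangle \<open>T\<close> are within 2 \<delta> of the segment
    [0, r], hence in \<open>S\<close>; \<delta> \<le> r keeps the centre \<open>t\<close> chosen
    below positive.\<close>
  define \<delta> where "\<delta> = min (\<epsilon> / 2) r"
  have \<delta>: "0 < \<delta>" "\<delta> \<le> r" "2 * \<delta> \<le> \<epsilon>" using \<open>0 < r\<close> \<open>\<epsilon> > 0\<close> by (auto simp: \<delta>_def)
  \<comment> \<open>A rectangle instead of the union of balls: its intersection with the disc of
    convergence is convex, hence connected, as the identity theorem for \<open>E_eq\<close>
    requires.\<close>
  define T where "T = box (Complex (-\<delta>) (-\<delta>)) (Complex (r + \<delta>) \<delta>)"
  have T: "z \<in> T \<longleftrightarrow> -\<delta> < Re z \<and> Re z < r + \<delta> \<and> \<bar>Im z\<bar> < \<delta>" for z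
    by (auto simp: T_def in_box_complex_iff)
  have "T \<subseteq> S"
  proof
    fix z assume z: "z \<in> T"
    define x where "x = max 0 (min r (Re z))"
    have "cmod (complex_of_real x - z) \<le> \<bar>x - Re z\<bar> + \<bar>Im z\<bar>"
      using cmod_le[of "complex_of_real x - z"] by simp
    also have "\<dots> < \<epsilon>" using z \<delta> \<open>0 < r\<close> by (auto simp: T x_def)
    finally have "z \<in> ball (complex_of_real x) \<epsilon>" by (simp add: dist_norm)
    moreover have "x \<in> {0..r}" using \<open>0 < r\<close> by (auto simp: x_def)
    ultimately show "z \<in> S" using \<epsilon> by blast
  qed
  then have holoT: "E holomorphic_on T" using holo holomorphic_on_subset by blast
  have "open T" "convex T" by (auto simp: T_def convex_box)
  obtain V where V: "open V" "0 \<in> V" "\<And>z. z \<in> V \<Longrightarrow> eval_fps e z = E z"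
    using e unfolding has_fps_expansion_def eventually_nhds by blast
  have "0 \<in> T" using \<delta> by (simp add: T)
  have E_eq: "E z = eval_fps e z" if "z \<in> T \<inter> ball 0 r" for z
  proof (rule analytic_continuation_open[of "V \<inter> T \<inter> ball 0 r" "T \<inter> ball 0 r" E "eval_fps e"])
    show "V \<inter> T \<inter> ball 0 r \<noteq> {}" using V \<open>0 \<in> T\<close> \<open>0 < r\<close> by auto
    show "connected (T \<inter> ball 0 r)"
      by (intro convex_connected convex_Int \<open>convex T\<close> convex_ball)
    show "E holomorphic_on T \<inter> ball 0 r" using holoT holomorphic_on_subset by blast
    show "eval_fps e holomorphic_on T \<inter> ball 0 r"
      by (rule holomorphic_on_eval_fps) (auto simp: rad in_eball_iff)
  qed (use V \<open>open T\<close> that in auto)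
  \<comment> \<open>The two points are \<delta> / 2 apart on either side of r, so the Taylor series
    at \<open>t\<close> reaches \<open>w\<close>, although \<open>w\<close> is outside the disc of
    convergence of \<open>e\<close>.\<close>
  define t where "t = complex_of_real (r - \<delta> / 4)"
  define w where "w = complex_of_real (r + \<delta> / 4)"
  have t: "t \<in> \<real>\<^sub>\<ge>\<^sub>0" "cmod t < r" and w: "w \<in> \<real>\<^sub>\<ge>\<^sub>0" "w \<in> ball t \<delta>" "w - t \<in> \<real>\<^sub>\<ge>\<^sub>0" "cmod w > r"
    unfolding t_def w_def using \<delta>
    by (auto simp: dist_norm complex_nonneg_Reals_iff simp del: of_real_add of_real_diff of_real_divide
      simp flip: of_real_diff)
  have "t \<in> T" using \<delta> by (simp add: T t_def)
  have ball_T: "ball t \<delta> \<subseteq> T"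
  proof
    fix z assume "z \<in> ball t \<delta>"
    then have "cmod (z - t) < \<delta>" by (simp add: dist_norm norm_minus_commute)
    with abs_Re_le_cmod[of "z - t"] abs_Im_le_cmod[of "z - t"]
    show "z \<in> T" using \<delta> by (auto simp: T t_def)
  qed
  have partial: "(\<Sum>n<N. cmod (fps_nth e n * w ^ n)) \<le> Re (E w)" for N
  proof -
    define P where "P = (\<lambda>z. \<Sum>n<N. fps_nth e n * z ^ n)"
    \<comment> \<open>The tail of \<open>e\<close>. Its coefficients are nonnegative and its radius
      is still r, so all derivatives of E - P at \<open>t\<close> can be computed from it.\<close>
    define d where "d = Abs_fps (\<lambda>n. if n < N then 0 else fps_nth e n)"
    have "fps_conv_radius d = fps_conv_radius e"
      unfolding fps_conv_radius_def
      by (rule conv_radius_cong) (auto simp: d_def eventually_sequentially intro!: exI[of _ N])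
    then have rad_d: "fps_conv_radius d = ereal r" using rad by simp
    have eval_d: "eval_fps d z = eval_fps e z - P z" if "cmod z < r" for z
    proof -
      have "(\<lambda>n. fps_nth e n * z ^ n) sums eval_fps e z"
        by (rule sums_eval_fps) (simp add: rad that)
      moreover have "(\<lambda>n. if n \<in> {..<N} then fps_nth e n * z ^ n else 0) sums P z"
        unfolding P_def by (rule sums_If_finite_set) simp
      ultimately have "(\<lambda>n. fps_nth e n * z ^ n - (if n \<in> {..<N} then fps_nth e n * z ^ n else 0))
          sums (eval_fps e z - P z)"
        by (rule sums_diff)
      also have "(\<lambda>n. fps_nth e n * z ^ n - (if n \<in> {..<N} then fps_nth e n * z ^ n else 0)) =
          (\<lambda>n. fps_nth d n * z ^ n)"
        by (auto simp: d_def)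
      finally show ?thesis by (simp add: eval_fps_def sums_iff)
    qed
    define g where "g = (\<lambda>z. E z - P z)"
    have "g holomorphic_on ball t \<delta>"
      unfolding g_def P_def using holoT ball_T
      by (intro holomorphic_intros) (rule holomorphic_on_subset)
    then have "(\<lambda>k. (deriv ^^ k) g t / fact k * (w - t) ^ k) sums g w"
      using w by (intro holomorphic_power_series) auto
    moreover have "(deriv ^^ k) g t / fact k * (w - t) ^ k \<in> \<real>\<^sub>\<ge>\<^sub>0" for k
    proof -
      have "eventually (\<lambda>z. z \<in> T \<inter> ball 0 r) (nhds t)"
        using \<open>t \<in> T\<close> t \<open>open T\<close> by (intro eventually_nhds_in_open) auto
      then have "eventually (\<lambda>z. g z = eval_fps d z) (nhds t)"
        by eventually_elim (simp add: g_def E_eq eval_d)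
      then have "(deriv ^^ k) g t = (deriv ^^ k) (eval_fps d) t"
        by (rule higher_deriv_cong_ev) simp
      moreover have "(deriv ^^ k) (eval_fps d) t \<in> \<real>\<^sub>\<ge>\<^sub>0"
        using t nonneg by (intro higher_deriv_eval_fps_nonneg_Reals) (auto simp: d_def rad_d[unfolded d_def])
      moreover have "(fact k :: complex) \<in> \<real>\<^sub>\<ge>\<^sub>0"
        by (metis nonneg_Reals_of_nat_I of_nat_fact)
      ultimately show ?thesis using w by auto
    qed
    ultimately have "g w \<in> \<real>\<^sub>\<ge>\<^sub>0" by (rule nonneg_Reals_sums)
    then have "Re (P w) \<le> Re (E w)" by (simp add: g_def complex_nonneg_Reals_iff)
    moreover have "cmod (fps_nth e n * w ^ n) = Re (fps_nth e n * w ^ n)" for n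
      using nonneg w by (intro nonneg_Reals_cmod_eq_Re) auto
    ultimately show ?thesis by (simp add: P_def)
  qed
  have "summable (\<lambda>n. cmod (fps_nth e n * w ^ n))"
  proof (rule bounded_imp_summable)
    show "(\<Sum>k\<le>n. cmod (fps_nth e k * w ^ k)) \<le> Re (E w)" for n
      using partial[of "Suc n"] by (simp add: lessThan_Suc_atMost)
  qed simp
  then have "summable (\<lambda>n. fps_nth e n * w ^ n)" by (rule summable_norm_cancel)
  then have "ereal (cmod w) \<le> fps_conv_radius e"
    unfolding fps_conv_radius_def by (rule conv_radius_geI)
  then show False using rad w by simp
qed

section \<open>Holomorphic functions with values in the sequence space\<close>

lemma bounded_bilinear_scaleC:
  "bounded_bilinear (scaleC :: complex \<Rightarrow> 'a::complex_normed_vector \<Rightarrow> 'a)"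
proof (unfold_locales, goal_cases)
  case (3 r c x)
  show ?case by (metis scaleC_of_real scaleC_scaleC scaleR_conv_of_real)
next
  case (4 c r x)
  show ?case by (metis mult.commute scaleC_of_real scaleC_scaleC)
next
  case 5
  show ?case by (rule exI[of _ 1]) (simp add: norm_scaleC)
qed (simp_all add: scaleC_add_left scaleC_add_right)

lemmas has_derivative_scaleC = bounded_bilinear.FDERIV[OF bounded_bilinear_scaleC]

lemma scaleC_one: "1 *\<^sub>C (x :: 'a::complex_normed_vector) = x"
  by (metis of_real_1 scaleC_of_real scaleR_one)

lemma sum_coord_le_norm: "(\<Sum>j<n. (cmod (coord x j))\<^sup>2) \<le> (norm x)\<^sup>2"
  unfolding norm_ell2_sq by (intro sum_le_suminf summable_coord) auto

lemma norm_coord_le: "cmod (coord x j) \<le> norm x"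
proof (rule power2_le_imp_le)
  have "(cmod (coord x j))\<^sup>2 \<le> (\<Sum>i<Suc j. (cmod (coord x i))\<^sup>2)"
    by (rule member_le_sum) auto
  also have "\<dots> \<le> (norm x)\<^sup>2" by (rule sum_coord_le_norm)
  finally show "(cmod (coord x j))\<^sup>2 \<le> (norm x)\<^sup>2" .
qed simp

lemma norm_ell2_leI:
  assumes "\<And>n. (\<Sum>j<n. (cmod (coord x j))\<^sup>2) \<le> K\<^sup>2" and "0 \<le> K"
  shows "norm x \<le> K"
proof (rule power2_le_imp_le)
  show "(norm x)\<^sup>2 \<le> K\<^sup>2"
    unfolding norm_ell2_sq by (intro suminf_le_const summable_coord assms)
qed fact

lemma bounded_linear_coord: "bounded_linear (\<lambda>x. coord x j)"
  by (rule bounded_linear_intro[where K = 1])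
    (auto simp: coord_plus coord_scaleR scaleR_conv_of_real norm_coord_le)

text \<open>Pairings with finitely many numbers \<open>y j\<close> are the functionals that turn
  maps into \<open>ell2\<close> into scalar functions. The Cauchy-Schwarz bound contains the full
  norm of x and is therefore uniform in the truncation n.\<close>

lemma norm_sum_coord_le:
  "cmod (\<Sum>j<n. coord x j * y j) \<le> norm x * L2_set (\<lambda>j. cmod (y j)) {..<n}"
proof -
  have "cmod (\<Sum>j<n. coord x j * y j) \<le> (\<Sum>j<n. \<bar>cmod (coord x j)\<bar> * \<bar>cmod (y j)\<bar>)"
    by (rule order_trans[OF norm_sum]) (simp add: norm_mult)
  also have "\<dots> \<le> L2_set (\<lambda>j. cmod (coord x j)) {..<n} * L2_set (\<lambda>j. cmod (y j)) {..<n}"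
    by (rule L2_set_mult_ineq)
  also have "L2_set (\<lambda>j. cmod (coord x j)) {..<n} \<le> norm x"
    unfolding L2_set_def by (rule real_le_lsqrt) (auto simp: sum_coord_le_norm sum_nonneg)
  finally show ?thesis by (simp add: mult_right_mono L2_set_nonneg)
qed

text \<open>The way back from functionals to norms: testing c against its own conjugate gives L^2
  \<le> K L for the length L of the truncation, and L cancels unless it is 0.\<close>

lemma sum_cmod_sq_le_of_dual:
  assumes "cmod (\<Sum>j<n. c j * cnj (c j)) \<le> K * L2_set (\<lambda>j. cmod (c j)) {..<n}" and "0 \<le> K"
  shows "(\<Sum>j<n. (cmod (c j))\<^sup>2) \<le> K\<^sup>2"
proof -
  let ?L = "L2_set (\<lambda>j. cmod (c j)) {..<n}"
  have L: "?L\<^sup>2 = (\<Sum>j<n. (cmod (c j))\<^sup>2)"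
    by (simp add: L2_set_def sum_nonneg)
  have "(\<Sum>j<n. c j * cnj (c j)) = complex_of_real (\<Sum>j<n. (cmod (c j))\<^sup>2)"
    by (simp add: complex_norm_square del: of_real_power)
  then have "cmod (\<Sum>j<n. c j * cnj (c j)) = ?L\<^sup>2"
    by (simp only: norm_of_real L) (simp add: sum_nonneg)
  then have "?L * ?L \<le> K * ?L"
    using assms(1) by (simp add: power2_eq_square)
  then have "?L \<le> K"
    using assms(2) L2_set_nonneg[of "\<lambda>j. cmod (c j)" "{..<n}"]
    by (metis linorder_not_le mult_le_cancel_right order_le_less)
  then show ?thesis using L L2_set_nonneg by (metis power_mono)
qed

text \<open>The constants are 2! / s^2 and 3! / (s/2)^3: discs of radius s/2 around points of
  \<open>ball z0 (s / 2)\<close> stay in \<open>cball z0 s\<close>, which bounds the third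
  derivative, and Taylor's formula of first order is applied to \<open>deriv g\<close>. Both bounds
  are linear in B, so they scale with the functional from which g is formed.\<close>

lemma second_order_Cauchy_bounds:
  fixes g :: "complex \<Rightarrow> complex"
  assumes holo: "g holomorphic_on A" and "open A" and s: "0 < s" "cball z0 s \<subseteq> A"
    and B: "\<And>z. z \<in> cball z0 s \<Longrightarrow> cmod (g z) \<le> B"
  shows "cmod (deriv (deriv g) z0) \<le> 2 / s\<^sup>2 * B"
    and "\<And>z. z \<in> ball z0 (s / 2) \<Longrightarrow>
      cmod (deriv g z - deriv g z0 - (z - z0) * deriv (deriv g) z0) \<le> 48 / s ^ 3 * B * (cmod (z - z0))\<^sup>2"
proof -
  have *: "cmod ((deriv ^^ n) g z) \<le> fact n * B / r ^ n" if "0 < r" "cball z r \<subseteq> cball z0 s" for n z r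
  proof (rule Cauchy_inequality)
    have "cball z r \<subseteq> A" using that s by blast
    then have "g holomorphic_on cball z r" using holo holomorphic_on_subset by blast
    then show "g holomorphic_on ball z r" "continuous_on (cball z r) g"
      using ball_subset_cball holomorphic_on_imp_continuous_on by (auto elim: holomorphic_on_subset)
    show "cmod (g x) \<le> B" if "cmod (z - x) = r" for x
      using that \<open>cball z r \<subseteq> cball z0 s\<close> by (intro B) (auto simp: dist_norm dest!: subsetD[where c = x])
  qed fact
  show "cmod (deriv (deriv g) z0) \<le> 2 / s\<^sup>2 * B"
    using *[of s z0 2] s by (simp add: eval_nat_numeral)
  fix z assume z: "z \<in> ball z0 (s / 2)"
  let ?f = "\<lambda>i. (deriv ^^ Suc i) g"
  have "cmod (?f 0 z - (\<Sum>i\<le>1. ?f i z0 * (z - z0) ^ i / fact i))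
      \<le> (48 / s ^ 3 * B) * cmod (z - z0) ^ Suc 1 / fact 1"
  proof (rule complex_Taylor[where S = "ball z0 (s / 2)"])
    fix i x assume x: "x \<in> ball z0 (s / 2)"
    then have "x \<in> A" using s by (auto simp: subset_eq)
    moreover have "?f i holomorphic_on A"
      by (rule holomorphic_higher_deriv) fact+
    ultimately show "(?f i has_field_derivative ?f (Suc i) x) (at x within ball z0 (s / 2))"
      using \<open>open A\<close> by (auto intro!: DERIV_subset[OF holomorphic_derivI])
  next
    fix x assume x: "x \<in> ball z0 (s / 2)"
    have "cball x (s / 2) \<subseteq> cball z0 s"
      using x by (simp add: cball_subset_cball_iff dist_commute)
    from *[OF _ this, of 3] show "cmod (?f (Suc 1) x) \<le> 48 / s ^ 3 * B"
      using s by (simp add: eval_nat_numeral field_simps)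
  qed (use z s in auto)
  then show "cmod (deriv g z - deriv g z0 - (z - z0) * deriv (deriv g) z0)
      \<le> 48 / s ^ 3 * B * (cmod (z - z0))\<^sup>2"
    by (simp add: power2_eq_square algebra_simps)
qed

text \<open>No completeness of \<open>ell2\<close> is used: the second derivative is built coordinatewise, and its
  norm and the norm of the remainder are bounded by pairing finitely many coordinates with
  themselves, which reduces both to Cauchy's estimates for scalar functions.\<close>
theorem ell2_holomorphic_derivative:
  fixes f d :: "complex \<Rightarrow> ell2"
  assumes "open A" and f: "\<And>z. z \<in> A \<Longrightarrow> (f has_derivative (\<lambda>v. v *\<^sub>C d z)) (at z)"
  obtains e where "\<And>z. z \<in> A \<Longrightarrow> (d has_derivative (\<lambda>v. v *\<^sub>C e z)) (at z)"
proof -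
  have "\<exists>e. (d has_derivative (\<lambda>v. v *\<^sub>C e)) (at z0)" if "z0 \<in> A" for z0
  proof -
    obtain s where s: "0 < s" "cball z0 s \<subseteq> A"
      using \<open>open A\<close> \<open>z0 \<in> A\<close> open_contains_cball by blast
    have "continuous_on A f"
      using f has_derivative_continuous continuous_at_imp_continuous_on by blast
    then have "compact (f ` cball z0 s)"
      using s continuous_on_subset by (intro compact_continuous_image) auto
    then obtain M where M: "0 < M" "\<And>z. z \<in> cball z0 s \<Longrightarrow> norm (f z) \<le> M"
      by (auto dest!: compact_imp_bounded simp: bounded_pos)
    define K where "K = 2 / s\<^sup>2 * M"
    define L where "L = 48 / s ^ 3 * M"
    have "0 \<le> K" "0 \<le> L" using s M by (auto simp: K_def L_def)
    define c where "c = (\<lambda>j. deriv (\<lambda>z. coord (d z) j) z0)"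
    have coord_f: "((\<lambda>z. coord (f z) j) has_field_derivative coord (d z) j) (at z)" if "z \<in> A" for z j
      using bounded_linear.has_derivative[OF bounded_linear_coord f[OF that], of j]
      by (rule has_derivative_imp_has_field_derivative) (simp add: coord_scaleC)
    have coord_d: "((\<lambda>z. coord (d z) j) has_field_derivative c j) (at z0)" for j
    proof -
      have "(\<lambda>z. coord (f z) j) holomorphic_on A"
        using coord_f \<open>open A\<close> by (auto simp: holomorphic_on_open)
      then have "deriv (\<lambda>z. coord (f z) j) holomorphic_on A"
        using \<open>open A\<close> by (rule holomorphic_deriv)
      moreover have "deriv (\<lambda>z. coord (f z) j) z = coord (d z) j" if "z \<in> A" for z
        using coord_f[OF that] by (rule DERIV_imp_deriv)
      ultimately have "(\<lambda>z. coord (d z) j) holomorphic_on A"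
        using holomorphic_transform by fastforce
      then show ?thesis unfolding c_def using \<open>open A\<close> \<open>z0 \<in> A\<close> by (rule holomorphic_derivI)
    qed
    \<comment> \<open>\<open>K\<close> and \<open>L\<close> depend on neither n nor y. This
      uniformity makes \<open>c\<close> square-summable and turns the coordinatewise remainders into
      an estimate in the norm of \<open>ell2\<close>.\<close>
    have bounds:
      "cmod (\<Sum>j<n. c j * y j) \<le> K * L2_set (\<lambda>j. cmod (y j)) {..<n}"
      "z \<in> ball z0 (s / 2) \<Longrightarrow>
        cmod (\<Sum>j<n. (coord (d z) j - coord (d z0) j - (z - z0) * c j) * y j)
          \<le> L * (cmod (z - z0))\<^sup>2 * L2_set (\<lambda>j. cmod (y j)) {..<n}" for n y z
    proof -
      define Y where "Y = L2_set (\<lambda>j. cmod (y j)) {..<n}"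
      define g where "g = (\<lambda>z. \<Sum>j<n. coord (f z) j * y j)"
      have g: "(g has_field_derivative (\<Sum>j<n. coord (d z) j * y j)) (at z)" if "z \<in> A" for z
        unfolding g_def by (intro DERIV_sum DERIV_cmult_right coord_f that)
      then have holo_g: "g holomorphic_on A" using \<open>open A\<close> by (auto simp: holomorphic_on_open)
      have le: "cmod (g z) \<le> M * Y" if "z \<in> cball z0 s" for z
      proof -
        have "cmod (g z) \<le> norm (f z) * Y" unfolding g_def Y_def by (rule norm_sum_coord_le)
        also have "\<dots> \<le> M * Y"
          using M(2)[OF that] by (intro mult_right_mono) (auto simp: Y_def L2_set_nonneg)
        finally show ?thesis .
      qed
      have g': "deriv g z = (\<Sum>j<n. coord (d z) j * y j)" if "z \<in> A" for z
        using g[OF that] by (rule DERIV_imp_deriv)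
      have g'': "deriv (deriv g) z0 = (\<Sum>j<n. c j * y j)"
      proof -
        have "((\<lambda>z. \<Sum>j<n. coord (d z) j * y j) has_field_derivative (\<Sum>j<n. c j * y j)) (at z0)"
          by (intro DERIV_sum DERIV_cmult_right coord_d)
        then have "(deriv g has_field_derivative (\<Sum>j<n. c j * y j)) (at z0)"
          by (rule has_field_derivative_transform_within_open[OF _ \<open>open A\<close> \<open>z0 \<in> A\<close>]) (simp add: g')
        then show ?thesis by (rule DERIV_imp_deriv)
      qed
      have b: "cmod (\<Sum>j<n. c j * y j) \<le> 2 / s\<^sup>2 * (M * Y)"
        "z \<in> ball z0 (s / 2) \<Longrightarrow> cmod (deriv g z - deriv g z0 - (z - z0) * (\<Sum>j<n. c j * y j))
          \<le> 48 / s ^ 3 * (M * Y) * (cmod (z - z0))\<^sup>2"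
        using second_order_Cauchy_bounds[OF holo_g \<open>open A\<close> s le] unfolding g'' by blast+
      show "cmod (\<Sum>j<n. c j * y j) \<le> K * L2_set (\<lambda>j. cmod (y j)) {..<n}"
        using b(1) unfolding K_def Y_def by (simp only: mult.assoc)
      assume z: "z \<in> ball z0 (s / 2)"
      then have "z \<in> A" using s by (auto simp: subset_eq)
      have "(\<Sum>j<n. (coord (d z) j - coord (d z0) j - (z - z0) * c j) * y j) =
          (\<Sum>j<n. coord (d z) j * y j) - (\<Sum>j<n. coord (d z0) j * y j) - (z - z0) * (\<Sum>j<n. c j * y j)"
        by (simp only: sum_subtractf sum_distrib_left left_diff_distrib mult.assoc)
      also have "\<dots> = deriv g z - deriv g z0 - (z - z0) * (\<Sum>j<n. c j * y j)"
        using g' \<open>z \<in> A\<close> \<open>z0 \<in> A\<close> by simp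
      finally show "cmod (\<Sum>j<n. (coord (d z) j - coord (d z0) j - (z - z0) * c j) * y j)
          \<le> L * (cmod (z - z0))\<^sup>2 * L2_set (\<lambda>j. cmod (y j)) {..<n}"
        using b(2)[OF z] by (simp add: L_def Y_def ac_simps)
    qed
    have "(\<Sum>j<n. (cmod (c j))\<^sup>2) \<le> K\<^sup>2" for n
      using bounds(1)[where n = n and y = "\<lambda>j. cnj (c j)"] \<open>0 \<le> K\<close>
      by (intro sum_cmod_sq_le_of_dual) simp_all
    then have "summable (\<lambda>j. (cmod (c j))\<^sup>2)"
      using bounded_imp_summable[of "\<lambda>j. (cmod (c j))\<^sup>2" "K\<^sup>2"] by (metis lessThan_Suc_atMost zero_le_power2)
    then have coord_e: "coord (Abs_ell2 c) j = c j" for j by (simp add: Abs_ell2_inverse)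
    have remainder: "norm (d z - d z0 - (z - z0) *\<^sub>C Abs_ell2 c) \<le> L * (cmod (z - z0))\<^sup>2"
      if z: "z \<in> ball z0 (s / 2)" for z
    proof (rule norm_ell2_leI)
      fix n
      show "(\<Sum>j<n. (cmod (coord (d z - d z0 - (z - z0) *\<^sub>C Abs_ell2 c) j))\<^sup>2)
          \<le> (L * (cmod (z - z0))\<^sup>2)\<^sup>2"
        using bounds(2)[OF z, where n = n and y = "\<lambda>j. cnj (coord (d z) j - coord (d z0) j - (z - z0) * c j)"] \<open>0 \<le> L\<close>
        unfolding coord_minus coord_scaleC coord_e
        by (intro sum_cmod_sq_le_of_dual) (simp_all only: complex_mod_cnj, auto)
    qed (use \<open>0 \<le> L\<close> in auto)
    have "(d has_derivative (\<lambda>v. v *\<^sub>C Abs_ell2 c)) (at z0 within ball z0 (s / 2))"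
    proof (rule has_derivativeI_sandwich[where e = "s / 2" and H = "\<lambda>z. L * cmod (z - z0)"])
      show "bounded_linear (\<lambda>v. v *\<^sub>C Abs_ell2 c)"
        by (rule bounded_bilinear.bounded_linear_left[OF bounded_bilinear_scaleC])
      show "((\<lambda>z. L * cmod (z - z0)) \<longlongrightarrow> 0) (at z0 within ball z0 (s / 2))"
        by (auto intro!: tendsto_eq_intros)
      fix z assume "z \<in> ball z0 (s / 2)" and "z \<noteq> z0"
      then show "norm ((d z - d z0) - (z - z0) *\<^sub>C Abs_ell2 c) / norm (z - z0) \<le> L * cmod (z - z0)"
        using remainder by (simp add: field_simps power2_eq_square)
    qed (use s in auto)
    then show ?thesis using s by (auto simp: at_within_open[where S = "ball z0 (s / 2)"])
  qed
  then have "\<exists>e. \<forall>z\<in>A. (d has_derivative (\<lambda>v. v *\<^sub>C e z)) (at z)"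
    by (intro bchoice) blast
  then show thesis using that by blast
qed

section \<open>Wirtinger derivatives and sums of squares\<close>

text \<open>The Hermitian product, linear in the first argument; the inner product of the class
  \<open>real_inner\<close> is its real part.\<close>

definition cinner :: "ell2 \<Rightarrow> ell2 \<Rightarrow> complex"
  where "cinner x y = (\<Sum>j. coord x j * cnj (coord y j))"

lemma sums_inner_ell2: "(\<lambda>j. coord x j \<bullet> coord y j) sums (x \<bullet> y)"
  unfolding inner_ell2_def by (rule summable_sums[OF summable_inner])

text \<open>The real products with y and with i y are the real and imaginary parts, so convergence,
  bilinearity and boundedness of \<open>cinner\<close> are inherited from the real inner
  product.\<close>

lemma cinner_sums_Complex:
  "(\<lambda>j. coord x j * cnj (coord y j)) sums Complex (x \<bullet> y) (x \<bullet> (\<i> *\<^sub>C y))"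
  using sums_inner_ell2[of x y] sums_inner_ell2[of x "\<i> *\<^sub>C y"]
  by (simp add: sums_complex_iff inner_complex_def coord_scaleC algebra_simps)

lemma cinner_sums: "(\<lambda>j. coord x j * cnj (coord y j)) sums cinner x y"
  using cinner_sums_Complex unfolding cinner_def by (metis sums_unique)

lemma cinner_eq_Complex: "cinner x y = Complex (x \<bullet> y) (x \<bullet> (\<i> *\<^sub>C y))"
  using cinner_sums_Complex cinner_sums sums_unique2 by blast

lemma cinner_scaleC_left: "cinner (c *\<^sub>C x) y = c * cinner x y"
  using sums_mult[OF cinner_sums[of x y], of c] cinner_sums[of "c *\<^sub>C x" y]
  by (auto simp: coord_scaleC mult.assoc dest: sums_unique2)

lemma cinner_commute: "cinner y x = cnj (cinner x y)"
  using sums_cnj[THEN iffD2, OF cinner_sums[of x y]] cinner_sums[of y x]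
  by (auto simp: mult.commute dest: sums_unique2)

lemma cinner_scaleC_right: "cinner x (c *\<^sub>C y) = cnj c * cinner x y"
  by (metis cinner_commute cinner_scaleC_left complex_cnj_mult)

lemma cinner_self: "cinner x x = complex_of_real ((norm x)\<^sup>2)"
proof -
  have "Im (cinner x x) = 0" using cinner_commute[of x x] by (metis cnj.simps(2) equal_neg_zero)
  then show ?thesis by (simp add: complex_eq_iff cinner_eq_Complex power2_norm_eq_inner)
qed

lemma bounded_bilinear_cinner: "bounded_bilinear cinner"
proof
  show "\<exists>K. \<forall>x y. cmod (cinner x y) \<le> norm x * norm y * K"
  proof (intro exI allI)
    fix x y
    have "cmod (cinner x y) \<le> \<bar>x \<bullet> y\<bar> + \<bar>x \<bullet> (\<i> *\<^sub>C y)\<bar>"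
      using cmod_le[of "cinner x y"] by (simp add: cinner_eq_Complex)
    also have "\<dots> \<le> norm x * norm y + norm x * norm (\<i> *\<^sub>C y)"
      by (intro add_mono Cauchy_Schwarz_ineq2)
    finally show "cmod (cinner x y) \<le> norm x * norm y * 2" by (simp add: norm_scaleC)
  qed
qed (simp_all add: cinner_eq_Complex scaleC_add_right inner_add_left inner_add_right complex_eq_iff,
   simp_all add: bounded_bilinear.scaleR_right[OF bounded_bilinear_scaleC])

text \<open>In the usual notation a is dF/dz and b is dF/d(cnj z). As a relation it yields
  differentiability and both values from one application of a rule; two computations for the same
  function are then compared by \<open>has_wirtinger_unique\<close>.\<close>

definition has_wirtinger ::
    "(complex \<Rightarrow> complex) \<Rightarrow> complex \<Rightarrow> complex \<Rightarrow> complex \<Rightarrow> bool"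
  where "has_wirtinger F a b z \<longleftrightarrow> (F has_derivative (\<lambda>v. v * a + cnj v * b)) (at z)"

lemma has_wirtinger_unique:
  assumes "has_wirtinger F a b z" and "has_wirtinger F c d z"
  shows "a = c" "b = d"
proof -
  have eq: "v * a + cnj v * b = v * c + cnj v * d" for v
    using has_derivative_unique[OF assms[unfolded has_wirtinger_def]] by meson
  have "a + b = c + d" using eq[of 1] by simp
  moreover have "\<i> * (a - b) = \<i> * (c - d)" using eq[of \<i>] by (simp add: algebra_simps)
  then have "a - b = c - d" by simp
  ultimately show "a = c" "b = d" by (auto simp: complex_eq_iff)
qed

section \<open>Rules of calculus for Wirtinger derivatives\<close>

lemma has_wirtinger_cong:
  assumes "has_wirtinger F a b z" and "open A" and "z \<in> A" and "\<And>w. w \<in> A \<Longrightarrow> F w = G w"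
  shows "has_wirtinger G a b z"
  using assms unfolding has_wirtinger_def by (rule has_derivative_transform_within_open)

lemma has_wirtinger_holomorphic: "has_wirtinger F a 0 z \<longleftrightarrow> (F has_field_derivative a) (at z)"
proof -
  have "(\<lambda>v. v * a) = (*) a" by (simp add: fun_eq_iff mult.commute)
  then show ?thesis by (simp add: has_wirtinger_def has_field_derivative_def)
qed

lemma has_wirtinger_compose:
  assumes "(E has_field_derivative E') (at (F z))" and "has_wirtinger F a b z"
  shows "has_wirtinger (\<lambda>z. E (F z)) (E' * a) (E' * b) z"
  using has_derivative_compose[OF assms(2)[unfolded has_wirtinger_def]
      assms(1)[unfolded has_field_derivative_def]]
  by (simp add: has_wirtinger_def algebra_simps)

lemma has_wirtinger_cnj:
  assumes "has_wirtinger F a b z"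
  shows "has_wirtinger (\<lambda>z. cnj (F z)) (cnj b) (cnj a) z"
  using has_derivative_cnj[OF assms[unfolded has_wirtinger_def]]
  by (simp add: has_wirtinger_def algebra_simps)

lemma has_wirtinger_add:
  assumes "has_wirtinger F a b z" and "has_wirtinger G c d z"
  shows "has_wirtinger (\<lambda>z. F z + G z) (a + c) (b + d) z"
  using has_derivative_add[OF assms[unfolded has_wirtinger_def]]
  by (simp add: has_wirtinger_def algebra_simps)

lemma has_wirtinger_diff:
  assumes "has_wirtinger F a b z" and "has_wirtinger G c d z"
  shows "has_wirtinger (\<lambda>z. F z - G z) (a - c) (b - d) z"
  using has_derivative_diff[OF assms[unfolded has_wirtinger_def]]
  by (simp add: has_wirtinger_def algebra_simps)

lemma has_wirtinger_mult:
  assumes "has_wirtinger F a b z" and "has_wirtinger G c d z"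
  shows "has_wirtinger (\<lambda>z. F z * G z) (a * G z + F z * c) (b * G z + F z * d) z"
  using has_derivative_mult[OF assms[unfolded has_wirtinger_def]]
  by (simp add: has_wirtinger_def algebra_simps)

lemma has_wirtinger_divide:
  assumes "has_wirtinger F a b z" and "has_wirtinger G c d z" and "G z \<noteq> 0"
  shows "has_wirtinger (\<lambda>z. F z / G z)
    ((a * G z - F z * c) / (G z)\<^sup>2) ((b * G z - F z * d) / (G z)\<^sup>2) z"
proof -
  have "has_wirtinger (\<lambda>z. inverse (G z)) (- inverse ((G z)\<^sup>2) * c) (- inverse ((G z)\<^sup>2) * d) z"
    using assms by (intro has_wirtinger_compose[of inverse])
      (auto intro!: derivative_eq_intros simp: power2_eq_square)
  from has_wirtinger_mult[OF assms(1) this] show ?thesis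
    using \<open>G z \<noteq> 0\<close> by (simp add: field_simps power2_eq_square)
qed

lemma has_wirtinger_id: "has_wirtinger (\<lambda>z. z) 1 0 z"
  by (simp add: has_wirtinger_def)

lemma has_wirtinger_cnj_id: "has_wirtinger cnj 0 1 z"
  using has_wirtinger_cnj[OF has_wirtinger_id] by simp

lemma has_wirtinger_const: "has_wirtinger (\<lambda>z. c) 0 0 z"
  by (simp add: has_wirtinger_def)

lemma has_wirtinger_radial:
  assumes "(E has_field_derivative E') (at (z * cnj z))"
  shows "has_wirtinger (\<lambda>z. E (z * cnj z)) (cnj z * E') (z * E') z"
  using has_wirtinger_compose[where F = "\<lambda>z. z * cnj z", OF assms
      has_wirtinger_mult[OF has_wirtinger_id has_wirtinger_cnj_id]]
  by (simp add: mult.commute)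

text \<open>Both maps are holomorphic, but \<open>cinner\<close> is conjugate linear in its second
  argument, so g' enters only the d/d(cnj z) slot.\<close>

lemma has_wirtinger_cinner:
  assumes "(f has_derivative (\<lambda>v. v *\<^sub>C f')) (at z)" and "(g has_derivative (\<lambda>v. v *\<^sub>C g')) (at z)"
  shows "has_wirtinger (\<lambda>z. cinner (f z) (g z)) (cinner f' (g z)) (cinner (f z) g') z"
  using bounded_bilinear.FDERIV[OF bounded_bilinear_cinner assms]
  by (simp add: has_wirtinger_def cinner_scaleC_left cinner_scaleC_right add.commute)

section \<open>Sums of squares and the signs of Taylor coefficients\<close>

lemma nonneg_Reals_of_real_mult_cancel:
  fixes z :: complex
  assumes "0 < k" and "complex_of_real k * z \<in> \<real>\<^sub>\<ge>\<^sub>0"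
  shows "z \<in> \<real>\<^sub>\<ge>\<^sub>0"
  using assms by (auto simp: complex_nonneg_Reals_iff zero_le_mult_iff)

text \<open>Applying \<open>\<partial>\<partial>\<close>-bar to \<open>E(|z|\<^sup>2) = |G|\<^sup>2 + |F|\<^sup>2\<close> yields an identity of the same form for
  \<open>G'\<close>, \<open>F'\<close> and \<open>(x E'(x))'\<close>, whose \<open>n\<close>-th Taylor coefficient is \<open>(n + 1)\<^sup>2\<close> times the
  \<open>(n + 1)\<close>-st one of \<open>E\<close>; so every Taylor coefficient of \<open>E\<close> is a positive multiple of the value
  at \<open>0\<close> of such a function.\<close>
theorem fps_nth_nonneg_of_sum_of_squares:
  fixes F F' :: "complex \<Rightarrow> ell2"
  assumes "E has_fps_expansion e" and "E holomorphic_on S" and "open S"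
    and "open A" and "0 \<in> A" and S: "\<And>z. z \<in> A \<Longrightarrow> z * cnj z \<in> S"
    and "G holomorphic_on A" and "\<And>z. z \<in> A \<Longrightarrow> (F has_derivative (\<lambda>v. v *\<^sub>C F' z)) (at z)"
    and "\<And>z. z \<in> A \<Longrightarrow> E (z * cnj z) = G z * cnj (G z) + cinner (F z) (F z)"
  shows "fps_nth e n \<in> \<real>\<^sub>\<ge>\<^sub>0"
  using assms(1,2) assms(7-)
proof (induction n arbitrary: E e G F F')
  case 0
  have "fps_nth e 0 = E 0" using "0.prems"(1) by (rule has_fps_expansion_imp_0_eq_fps_nth_0[symmetric])
  also have "\<dots> = G 0 * cnj (G 0) + cinner (F 0) (F 0)" using "0.prems"(5)[OF \<open>0 \<in> A\<close>] by simp
  also have "\<dots> = complex_of_real ((cmod (G 0))\<^sup>2 + (norm (F 0))\<^sup>2)"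
    by (simp add: cinner_self complex_norm_square del: of_real_power)
  finally show ?case by (simp only: nonneg_Reals_of_real_iff) simp
next
  case (Suc n)
  note F = \<open>\<And>z. z \<in> A \<Longrightarrow> (F has_derivative (\<lambda>v. v *\<^sub>C F' z)) (at z)\<close>
  obtain F'' where F': "\<And>z. z \<in> A \<Longrightarrow> (F' has_derivative (\<lambda>v. v *\<^sub>C F'' z)) (at z)"
    using ell2_holomorphic_derivative[OF \<open>open A\<close> F] by blast
  have E: "(E has_field_derivative deriv E x) (at x)"
    and E': "(deriv E has_field_derivative deriv (deriv E) x) (at x)" if "x \<in> S" for x
    using that Suc.prems(2) \<open>open S\<close> by (auto intro: holomorphic_derivI holomorphic_deriv)
  have G: "has_wirtinger G (deriv G z) 0 z"
    and G': "has_wirtinger (deriv G) (deriv (deriv G) z) 0 z" if "z \<in> A" for z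
    using that Suc.prems(3) \<open>open A\<close>
    by (auto simp: has_wirtinger_holomorphic intro: holomorphic_derivI holomorphic_deriv)
  \<comment> \<open>The d/d(cnj z) derivatives of both sides. Taking d/dz of this identity
    afterwards turns z E'(z cnj z) into \<open>E1 (z * cnj z)\<close>.\<close>
  have first: "z * deriv E (z * cnj z) = G z * cnj (deriv G z) + cinner (F z) (F' z)"
    if z: "z \<in> A" for z
  proof -
    have "has_wirtinger (\<lambda>z. G z * cnj (G z) + cinner (F z) (F z))
        (cnj z * deriv E (z * cnj z)) (z * deriv E (z * cnj z)) z"
      using has_wirtinger_radial[OF E[OF S[OF z]]] \<open>open A\<close> z Suc.prems(5)
      by (rule has_wirtinger_cong)
    from has_wirtinger_unique(2)[OF this has_wirtinger_add[OF
          has_wirtinger_mult[OF G[OF z] has_wirtinger_cnj[OF G[OF z]]]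
          has_wirtinger_cinner[OF F[OF z] F[OF z]]]]
    show ?thesis by simp
  qed
  define E1 where "E1 = (\<lambda>x. deriv E x + x * deriv (deriv E) x)"
  define e1 where "e1 = fps_deriv e + fps_X * fps_deriv (fps_deriv e)"
  have "fps_nth e1 n \<in> \<real>\<^sub>\<ge>\<^sub>0"
  proof (rule Suc.IH)
    show "E1 has_fps_expansion e1"
      unfolding E1_def e1_def using Suc.prems(1) by (intro fps_expansion_intros)
    show "E1 holomorphic_on S"
      unfolding E1_def using Suc.prems(2) \<open>open S\<close> by (intro holomorphic_intros)
    show "deriv G holomorphic_on A"
      using Suc.prems(3) \<open>open A\<close> by (rule holomorphic_deriv)
    fix z assume z: "z \<in> A"
    show "(F' has_derivative (\<lambda>v. v *\<^sub>C F'' z)) (at z)" by (rule F'[OF z])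
    have "has_wirtinger (\<lambda>z. G z * cnj (deriv G z) + cinner (F z) (F' z))
       (1 * deriv E (z * cnj z) + z * (cnj z * deriv (deriv E) (z * cnj z)))
       (0 * deriv E (z * cnj z) + z * (z * deriv (deriv E) (z * cnj z))) z"
      using has_wirtinger_mult[OF has_wirtinger_id has_wirtinger_radial[OF E'[OF S[OF z]]]]
        \<open>open A\<close> z first by (rule has_wirtinger_cong)
    from has_wirtinger_unique(1)[OF this has_wirtinger_add[OF
          has_wirtinger_mult[OF G[OF z] has_wirtinger_cnj[OF G'[OF z]]]
          has_wirtinger_cinner[OF F[OF z] F'[OF z]]]]
    show "E1 (z * cnj z) = deriv G z * cnj (deriv G z) + cinner (F' z) (F' z)"
      by (simp add: E1_def mult.assoc)
  qed
  \<comment> \<open>The first summand of \<open>e1\<close> contributes the factor n + 1, the second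
    n (n + 1); at n = 0 multiplication by \<open>fps_X\<close> leaves nothing of the second.\<close>
  moreover have "fps_nth e1 n = complex_of_real ((real n + 1)\<^sup>2) * fps_nth e (Suc n)"
    by (cases n) (auto simp: e1_def algebra_simps power2_eq_square)
  ultimately have "complex_of_real ((real n + 1)\<^sup>2) * fps_nth e (Suc n) \<in> \<real>\<^sub>\<ge>\<^sub>0" by simp
  then show ?case by (rule nonneg_Reals_of_real_mult_cancel[rotated]) simp
qed

text \<open>Calabi's rigidity in one variable: \<open>log (1 + |f|\<^sup>2) - p(|z|\<^sup>2)\<close> is harmonic, hence the
  real part of a holomorphic function \<open>2 H\<close>, and \<open>exp (- H)\<close> times the vector \<open>(1, f)\<close> has
  squared length \<open>exp (p(|z|\<^sup>2))\<close>, up to a positive constant.\<close>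
lemma exp_radial_eq_sum_of_squares:
  fixes f d :: "complex \<Rightarrow> ell2"
  assumes "open S" and p: "p holomorphic_on S"
    and A: "A = ball 0 \<delta>" "0 < \<delta>" and S: "\<And>z. z \<in> A \<Longrightarrow> z * cnj z \<in> S"
    and real: "\<And>z. z \<in> A \<Longrightarrow> p (z * cnj z) \<in> \<real>"
    and f: "\<And>z. z \<in> A \<Longrightarrow> (f has_derivative (\<lambda>v. v *\<^sub>C d z)) (at z)"
    and eq: "\<And>z. z \<in> A \<Longrightarrow> deriv p (z * cnj z) + z * cnj z * deriv (deriv p) (z * cnj z) =
      cinner (d z) (d z) / (1 + cinner (f z) (f z)) -
      cinner (d z) (f z) * cinner (f z) (d z) / (1 + cinner (f z) (f z))\<^sup>2"
  obtains G F F' where "G holomorphic_on A"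
    and "\<And>z. z \<in> A \<Longrightarrow> (F has_derivative (\<lambda>v. v *\<^sub>C F' z)) (at z)"
    and "\<And>z. z \<in> A \<Longrightarrow> exp (p (z * cnj z)) = G z * cnj (G z) + cinner (F z) (F z)"
proof -
  have "open A" "convex A" "0 \<in> A" using A by auto
  obtain e where d: "\<And>z. z \<in> A \<Longrightarrow> (d has_derivative (\<lambda>v. v *\<^sub>C e z)) (at z)"
    using ell2_holomorphic_derivative[OF \<open>open A\<close> f] by blast
  have p': "(p has_field_derivative deriv p x) (at x)"
    and p'': "(deriv p has_field_derivative deriv (deriv p) x) (at x)" if "x \<in> S" for x
    using that p \<open>open S\<close> by (auto intro: holomorphic_derivI holomorphic_deriv)
  define Q where "Q = (\<lambda>z. 1 + cinner (f z) (f z))"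
  have Q_real: "Q z = complex_of_real (1 + (norm (f z))\<^sup>2)" for z
    by (simp add: Q_def cinner_self)
  have Q_pos: "1 + (norm (f z))\<^sup>2 > 0" for z
    by (intro add_pos_nonneg) auto
  then have Q_nz: "Q z \<noteq> 0" for z
    unfolding Q_real of_real_eq_0_iff by (simp add: less_imp_neq[symmetric])
  have Q: "has_wirtinger Q (cinner (d z) (f z)) (cinner (f z) (d z)) z" if "z \<in> A" for z
    unfolding Q_def
    using has_wirtinger_add[OF has_wirtinger_const has_wirtinger_cinner[OF f[OF that] f[OF that]]]
    by simp
  \<comment> \<open>The d/dz derivative of log (1 + |f|^2) - p(|z|^2). Its own d/d(cnj z) derivative
    vanishes by \<open>eq\<close>, so it has a primitive H, and the real function it came from is 2
    Re H up to a constant.\<close>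
  define q where "q = (\<lambda>z. cinner (d z) (f z) / Q z - cnj z * deriv p (z * cnj z))"
  have "\<exists>q'. (q has_field_derivative q') (at z)" if z: "z \<in> A" for z
  proof -
    have zero: "(cinner (d z) (d z) * Q z - cinner (d z) (f z) * cinner (f z) (d z)) / (Q z)\<^sup>2
        - (1 * deriv p (z * cnj z) + cnj z * (z * deriv (deriv p) (z * cnj z))) = 0"
    proof -
      have "1 + cinner (f z) (f z) = Q z" by (simp add: Q_def)
      then show ?thesis using eq[OF z] Q_nz[of z] by (simp add: field_simps power2_eq_square)
    qed
    show ?thesis
      using has_wirtinger_diff[OF
          has_wirtinger_divide[OF has_wirtinger_cinner[OF d[OF z] f[OF z]] Q[OF z] Q_nz]
          has_wirtinger_mult[OF has_wirtinger_cnj_id has_wirtinger_radial[OF p''[OF S[OF z]]]]]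
      unfolding zero by (auto simp: has_wirtinger_holomorphic q_def)
  qed
  then have "q holomorphic_on A" using \<open>open A\<close> by (auto simp: holomorphic_on_open)
  then obtain H where H: "\<And>z. z \<in> A \<Longrightarrow> (H has_field_derivative q z) (at z)"
    using holomorphic_convex_primitive'[OF \<open>convex A\<close> \<open>open A\<close>] \<open>open A\<close> by (metis at_within_open)
  \<comment> \<open>Reality is assumed for p along |z|^2, not for its derivative; it is transferred
    by computing the derivatives of the conjugate in two ways.\<close>
  have symm: "z * cnj (deriv p (z * cnj z)) = z * deriv p (z * cnj z)" if z: "z \<in> A" for z
  proof -
    have rad: "has_wirtinger (\<lambda>z. p (z * cnj z))
        (cnj z * deriv p (z * cnj z)) (z * deriv p (z * cnj z)) z"
      by (rule has_wirtinger_radial[OF p'[OF S[OF z]]])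
    have "has_wirtinger (\<lambda>z. cnj (p (z * cnj z)))
        (cnj z * deriv p (z * cnj z)) (z * deriv p (z * cnj z)) z"
      by (rule has_wirtinger_cong[OF rad \<open>open A\<close> z]) (metis Reals_cnj_iff real)
    from has_wirtinger_unique(2)[OF has_wirtinger_cnj[OF rad] this] show ?thesis by simp
  qed
  \<comment> \<open>The exponential of p(|z|^2) + 2 Re H - log (1 + |f|^2). Both of its Wirtinger
    derivatives vanish, which gives constancy without taking a logarithm.\<close>
  define W where "W = (\<lambda>z. exp (p (z * cnj z)) * (exp (H z) * cnj (exp (H z))) / Q z)"
  have "(W has_derivative (\<lambda>v. 0)) (at z)" if z: "z \<in> A" for z
  proof -
    have exp_p: "has_wirtinger (\<lambda>z. exp (p (z * cnj z)))
        (exp (p (z * cnj z)) * (cnj z * deriv p (z * cnj z)))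
        (exp (p (z * cnj z)) * (z * deriv p (z * cnj z))) z"
      by (intro has_wirtinger_compose[of exp] DERIV_exp has_wirtinger_radial[OF p'[OF S[OF z]]])
    have exp_H: "has_wirtinger (\<lambda>z. exp (H z)) (exp (H z) * q z) (exp (H z) * 0) z"
      using H[OF z] by (intro has_wirtinger_compose[of exp] DERIV_exp)
        (simp add: has_wirtinger_holomorphic)
    define P where "P = exp (p (z * cnj z))"
    define h where "h = exp (H z)"
    define D where "D = deriv p (z * cnj z)"
    define n where "n = cinner (d z) (f z)"
    have cnj_Q: "cnj (Q z) = Q z" by (simp add: Q_real)
    have n': "cinner (f z) (d z) = cnj n" unfolding n_def by (rule cinner_commute)
    have q: "q z = n / Q z - cnj z * D" "cnj (q z) = cnj n / Q z - z * D"
      using symm[OF z] by (simp_all add: q_def n_def D_def cnj_Q)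
    have 1: "((P * (cnj z * D) * (h * cnj h) + P * (h * q z * cnj h + h * cnj (h * 0))) * Q z
        - P * (h * cnj h) * n) / (Q z)\<^sup>2 = 0"
      using Q_nz[of z] by (simp add: q field_simps)
    have 2: "((P * (z * D) * (h * cnj h) + P * (h * 0 * cnj h + h * cnj (h * q z))) * Q z
        - P * (h * cnj h) * cnj n) / (Q z)\<^sup>2 = 0"
      using Q_nz[of z] unfolding complex_cnj_mult q(2) by (simp add: field_simps)
    have "has_wirtinger W 0 0 z"
      using has_wirtinger_divide[OF has_wirtinger_mult[OF exp_p
            has_wirtinger_mult[OF exp_H has_wirtinger_cnj[OF exp_H]]] Q[OF z] Q_nz]
      unfolding W_def P_def[symmetric] h_def[symmetric] D_def[symmetric] n' n_def[symmetric] 1 2 .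
    then show ?thesis by (simp add: has_wirtinger_def)
  qed
  then have W_const: "W z = W 0" if "z \<in> A" for z
    using has_derivative_zero_unique[OF \<open>convex A\<close> has_derivative_at_withinI] that \<open>0 \<in> A\<close> by blast
  define c where "c = exp (Re (p 0)) * (cmod (exp (H 0)))\<^sup>2 / (1 + (norm (f 0))\<^sup>2)"
  have "0 \<le> c" using Q_pos by (simp add: c_def)
  have "p 0 = complex_of_real (Re (p 0))" using real[OF \<open>0 \<in> A\<close>] by simp
  then have "exp (p 0) = complex_of_real (exp (Re (p 0)))" by (metis exp_of_real)
  then have W0: "W 0 = complex_of_real c"
    unfolding W_def c_def Q_real complex_norm_square[symmetric] by simp
  \<comment> \<open>The constant \<open>c\<close> is the value of \<open>W\<close> at 0 and is
    nonnegative, so its square root can be absorbed and the identity becomes exact; the second map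
    is G times f.\<close>
  define G where "G = (\<lambda>z. complex_of_real (sqrt c) * exp (- H z))"
  define G' where "G' = (\<lambda>z. complex_of_real (sqrt c) * (exp (- H z) * - q z))"
  have G: "(G has_field_derivative G' z) (at z)" if "z \<in> A" for z
    unfolding G_def G'_def by (intro DERIV_cmult DERIV_fun_exp DERIV_minus H that)
  show thesis
  proof
    show "G holomorphic_on A" using G \<open>open A\<close> by (auto simp: holomorphic_on_open)
    fix z assume z: "z \<in> A"
    have "(G has_derivative (\<lambda>v. v * G' z)) (at z)"
      using G[OF z] by (simp add: has_wirtinger_holomorphic[symmetric] has_wirtinger_def)
    from has_derivative_scaleC[OF this f[OF z]]
    show "((\<lambda>z. G z *\<^sub>C f z) has_derivative (\<lambda>v. v *\<^sub>C (G z *\<^sub>C d z + G' z *\<^sub>C f z))) (at z)"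
      by (simp add: scaleC_add_right scaleC_scaleC mult.commute)
    have "exp (p (z * cnj z)) * (exp (H z) * cnj (exp (H z))) / Q z = complex_of_real c"
      using W_const[OF z] W0 by (simp only: W_def)
    then have "exp (p (z * cnj z)) = complex_of_real c * Q z * (exp (- H z) * cnj (exp (- H z)))"
      using Q_nz[of z] by (simp add: field_simps exp_minus exp_cnj)
    also have "\<dots> = G z * cnj (G z) * Q z"
      using \<open>0 \<le> c\<close> by (simp add: G_def flip: of_real_mult)
    also have "\<dots> = G z * cnj (G z) + cinner (G z *\<^sub>C f z) (G z *\<^sub>C f z)"
      by (simp add: Q_def cinner_scaleC_left cinner_scaleC_right algebra_simps)
    finally show "exp (p (z * cnj z)) = G z * cnj (G z) + cinner (G z *\<^sub>C f z) (G z *\<^sub>C f z)" .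
  qed
qed

section \<open>Kaehler forms\<close>

text \<open>\<open>frechet_derivative\<close> is a choice among derivatives, so it is enough that
  the same D qualify for f and g; this covers functions that are not differentiable.\<close>

lemma frechet_derivative_cong_open:
  assumes "open A" and "x \<in> A" and "\<And>y. y \<in> A \<Longrightarrow> f y = g y"
  shows "frechet_derivative f (at x) = frechet_derivative g (at x)"
proof -
  have "(f has_derivative D) (at x) \<longleftrightarrow> (g has_derivative D) (at x)" for D
    using assms has_derivative_transform_within_open[of f D x UNIV A g]
      has_derivative_transform_within_open[of g D x UNIV A f] by auto
  then show ?thesis by (simp add: frechet_derivative_def)
qed

lemma del_cong_open:
  assumes "open A" and "x \<in> A" and "\<And>y. y \<in> A \<Longrightarrow> f y = g y"
  shows "del u f x = del u g x"
  unfolding del_def using frechet_derivative_cong_open[OF assms] by simp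

lemma del_eq:
  assumes "(f has_derivative D) (at x)"
  shows "del u f x = (D u - \<i> * D (\<i> *\<^sub>C u)) / 2"
  using frechet_derivative_at[OF assms] by (simp add: del_def)

lemma delbar_eq:
  assumes "(f has_derivative D) (at x)"
  shows "delbar u f x = (D u + \<i> * D (\<i> *\<^sub>C u)) / 2"
  using frechet_derivative_at[OF assms] by (simp add: delbar_def)

lemma del_wirtinger:
  assumes "has_wirtinger F a b z"
  shows "del u F z = u * a"
  using del_eq[OF assms[unfolded has_wirtinger_def], of u]
  by (simp add: scaleC_complex_def algebra_simps)

lemma delbar_wirtinger:
  assumes "has_wirtinger F a b z"
  shows "delbar u F z = cnj u * b"
  using delbar_eq[OF assms[unfolded has_wirtinger_def], of u]
  by (simp add: scaleC_complex_def algebra_simps)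

text \<open>The d/d(cnj z) derivative of p(|z|^2) is z p'(|z|^2), and d/dz of that gives the factor
  (x p'(x))' at x = |z|^2.\<close>

lemma ddbar_radial:
  assumes "open S" and "p holomorphic_on S" and "open A" and "z \<in> A"
    and S: "\<And>y. y \<in> A \<Longrightarrow> y * cnj y \<in> S"
    and \<Phi>: "\<And>y. y \<in> A \<Longrightarrow> complex_of_real (\<Phi> y) = p (y * cnj y)"
  shows "ddbar \<Phi> z u v =
    (deriv p (z * cnj z) + z * cnj z * deriv (deriv p) (z * cnj z)) * (u * cnj v - v * cnj u)"
proof -
  have p': "(p has_field_derivative deriv p x) (at x)"
    and p'': "(deriv p has_field_derivative deriv (deriv p) x) (at x)" if "x \<in> S" for x
    using that assms(1,2) by (auto intro: holomorphic_derivI holomorphic_deriv)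
  have "del u (delbar v (\<lambda>y. complex_of_real (\<Phi> y))) z =
      u * (cnj v * (deriv p (z * cnj z) + z * cnj z * deriv (deriv p) (z * cnj z)))" for u v
  proof -
    have "delbar v (\<lambda>y. complex_of_real (\<Phi> y)) y = cnj v * (y * deriv p (y * cnj y))" if "y \<in> A" for y
      using has_wirtinger_cong[OF has_wirtinger_radial[OF p'[OF S[OF that]]] \<open>open A\<close> that \<Phi>[symmetric]]
      by (rule delbar_wirtinger)
    then have "del u (delbar v (\<lambda>y. complex_of_real (\<Phi> y))) z =
        del u (\<lambda>y. cnj v * (y * deriv p (y * cnj y))) z"
      by (rule del_cong_open[OF \<open>open A\<close> \<open>z \<in> A\<close>])
    also have "\<dots> = u * (cnj v * (deriv p (z * cnj z) + z * cnj z * deriv (deriv p) (z * cnj z)))"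
      using del_wirtinger[OF has_wirtinger_mult[OF has_wirtinger_const has_wirtinger_mult[OF
            has_wirtinger_id has_wirtinger_radial[OF p''[OF S[OF \<open>z \<in> A\<close>]]]]], of u "cnj v"]
      by (simp add: mult.assoc)
    finally show ?thesis .
  qed
  then show ?thesis by (simp add: ddbar_def algebra_simps)
qed

text \<open>The real derivative of log (1 + |w|^2) in direction s is 2 (w . s) / (1 + |w|^2);
  combining s = v with s = i v produces \<open>cinner w v\<close>. No coordinates enter, so the
  dimension does not matter.\<close>

lemma del_delbar_log:
  "del u (delbar v (\<lambda>w. complex_of_real (ln (1 + (norm w)\<^sup>2)))) w =
    cinner u v / (1 + cinner w w) - cinner w v * cinner u w / (1 + cinner w w)\<^sup>2"
proof -
  let ?Q = "\<lambda>w::ell2. complex_of_real (1 + w \<bullet> w)"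
  have pos: "1 + w \<bullet> w > 0" for w :: ell2 by (intro add_pos_nonneg) auto
  then have nz: "?Q w \<noteq> 0" for w by (metis less_irrefl of_real_eq_0_iff)
  have cinner_add: "cinner w v = complex_of_real (w \<bullet> v) + \<i> * complex_of_real (w \<bullet> (\<i> *\<^sub>C v))" for w v
    by (simp add: cinner_eq_Complex complex_eq_iff)
  have cinner_diff: "cinner v w = complex_of_real (w \<bullet> v) - \<i> * complex_of_real (w \<bullet> (\<i> *\<^sub>C v))" for w v
    by (subst cinner_commute) (simp add: cinner_add)
  have deriv_Q: "((\<lambda>w. 1 + w \<bullet> w) has_derivative (\<lambda>s. 2 * (w \<bullet> s))) (at w)" for w :: ell2
    by (auto intro!: derivative_eq_intros simp: inner_commute)
  have log_deriv: "((\<lambda>w. complex_of_real (ln (1 + (norm w)\<^sup>2))) has_derivative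
      (\<lambda>s. complex_of_real (2 * (w \<bullet> s) * inverse (1 + w \<bullet> w)))) (at w)" for w :: ell2
    unfolding power2_norm_eq_inner by (intro has_derivative_of_real has_derivative_ln deriv_Q pos)
  have delbar: "delbar v (\<lambda>w. complex_of_real (ln (1 + (norm w)\<^sup>2))) w = cinner w v / ?Q w" for w
  proof -
    have "(complex_of_real (2 * a * c) + \<i> * complex_of_real (2 * b * c)) / 2 =
        (complex_of_real a + \<i> * complex_of_real b) * complex_of_real c" for a b c
      by (simp add: complex_eq_iff)
    then show ?thesis
      unfolding delbar_eq[OF log_deriv] cinner_add divide_inverse of_real_inverse[symmetric] .
  qed
  have quot: "((\<lambda>w. cinner w v / ?Q w) has_derivative
      (\<lambda>s. cinner s v / ?Q w - cinner w v * complex_of_real (2 * (w \<bullet> s)) / (?Q w)\<^sup>2)) (at w)"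
  proof -
    have num: "((\<lambda>w. cinner w v) has_derivative (\<lambda>s. cinner s v)) (at w)"
      by (rule bounded_linear_imp_has_derivative)
        (rule bounded_bilinear.bounded_linear_left[OF bounded_bilinear_cinner])
    show ?thesis
      by (rule has_derivative_eq_rhs[OF has_derivative_divide[OF num has_derivative_of_real[OF deriv_Q] nz]])
        (use nz in \<open>simp add: fun_eq_iff field_simps power2_eq_square\<close>)
  qed
  \<comment> \<open>The numerator is complex linear in the direction and passes through
    \<open>del\<close> unchanged; from the denominator, which varies only real linearly,
    \<open>del\<close> extracts \<open>cinner u w\<close>.\<close>
  have split: "(a / q - b * complex_of_real (2 * x) / r - \<i> * (\<i> * a / q - b * complex_of_real (2 * y) / r)) / 2 =
      a / q - b * (complex_of_real x - \<i> * complex_of_real y) / r" for a b q r x y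
  proof -
    have "(c - d * (2 * s) - \<i> * (\<i> * c - d * (2 * t))) / 2 = c - d * (s - \<i> * t)" for c d s t
      by (simp add: field_simps)
    from this[of "a / q" "b / r" "complex_of_real x" "complex_of_real y"] show ?thesis by simp
  qed
  have "del u (\<lambda>w. cinner w v / ?Q w) w =
      (cinner u v / ?Q w - cinner w v * complex_of_real (2 * (w \<bullet> u)) / (?Q w)\<^sup>2 -
      \<i> * (\<i> * cinner u v / ?Q w - cinner w v * complex_of_real (2 * (w \<bullet> (\<i> *\<^sub>C u))) / (?Q w)\<^sup>2)) / 2"
    by (simp only: del_eq[OF quot] cinner_scaleC_left)
  also have "\<dots> = cinner u v / ?Q w - cinner w v * cinner u w / (?Q w)\<^sup>2"
    by (simp only: split cinner_diff[of u w])
  finally have "del u (\<lambda>w. cinner w v / ?Q w) w =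
      cinner u v / ?Q w - cinner w v * cinner u w / (?Q w)\<^sup>2" .
  moreover have "?Q w = 1 + cinner w w" by (simp add: cinner_self power2_norm_eq_inner)
  ultimately show ?thesis unfolding delbar by simp
qed

text \<open>With X the right-hand side, the two terms of \<open>ddbar\<close> at (u, i u) are -i X
  and i X, and i/2 times their difference is X. Since X equals its conjugate, \<open>Re\<close>
  loses nothing. The diagonal suffices because the disc has complex dimension one.\<close>

lemma fubini_study_self:
  fixes D :: "(ell2 set, ell2) chart" and L :: "ell2 set"
  defines "w \<equiv> snd D L"
  shows "complex_of_real (fubini_study D L u u) =
    cinner u u / (1 + cinner w w) -
    cinner u w * cinner w u / (1 + cinner w w)\<^sup>2"
proof -
  define X where "X = cinner u u / (1 + cinner w w) -
    cinner u w * cinner w u / (1 + cinner w w)\<^sup>2"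
  have "\<i> / 2 * ddbar (\<lambda>w. ln (1 + (norm w)\<^sup>2)) w u (\<i> *\<^sub>C u) = X"
    by (simp add: ddbar_def del_delbar_log cinner_scaleC_left cinner_scaleC_right X_def algebra_simps
        diff_divide_distrib)
  moreover have "cnj X = X"
    by (simp add: X_def cinner_commute[symmetric] mult.commute)
  ultimately show ?thesis
    unfolding fubini_study_def w_def[symmetric] X_def[symmetric]
    by (simp add: Reals_cnj_iff)
qed

section \<open>The immersion on the disc\<close>

lemma open_disc: "open (disc \<rho>)"
proof (cases \<rho>)
  case (real r)
  then have "disc \<rho> = {z. (cmod z)\<^sup>2 < r}" by (simp add: disc_def)
  then show ?thesis by (simp add: open_Collect_less continuous_intros)
qed (simp_all add: disc_def)

lemma topspace_disc_manifold: "topspace (mtop (disc_manifold \<rho>)) = disc \<rho>"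
  by (simp add: disc_manifold_def)

lemma disc_chart_in_atlas: "(disc \<rho>, id) \<in> atlas (disc_manifold \<rho>)"
  by (simp add: disc_manifold_def)

lemma chart_inv_chart:
  assumes "complex_manifold M" and "C \<in> atlas M" and "q \<in> fst C"
  shows "chart_inv C (snd C q) = q"
proof (rule inv_into_f_f)
  have "openin (mtop M) (fst C)"
    and "homeomorphic_map (subtopology (mtop M) (fst C)) (top_of_set (snd C ` fst C)) (snd C)"
    using assms by (auto simp: complex_manifold_def)
  then show "inj_on (snd C) (fst C)"
    using homeomorphic_imp_injective_map openin_subset by (fastforce simp: Int_absorb1)
qed fact

section \<open>Affine charts of projective space\<close>

lemma cline_eq_imp_coord_nonzero:
  assumes "cline Z = cline Y" and "coord Y k \<noteq> 0"
  shows "coord Z k \<noteq> 0"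
proof -
  have "Y \<in> cline Y" unfolding cline_def using scaleC_one[of Y] by (metis rangeI)
  then obtain c where "Y = c *\<^sub>C Z" using assms(1) by (auto simp: cline_def)
  then show ?thesis using assms(2) by (auto simp: coord_scaleC)
qed

lemma openin_affine_chart: "openin (proj_topology N) (fst (affine_chart N k))"
proof -
  let ?V = "hom_coords N - {0}"
  let ?U = "cline ` {Z \<in> hom_coords N. coord Z k \<noteq> 0}"
  have "{Z \<in> ?V. cline Z \<in> ?U} = ?V \<inter> {Z. coord Z k \<noteq> 0}"
  proof (intro equalityI subsetI)
    fix Z assume "Z \<in> {Z \<in> ?V. cline Z \<in> ?U}"
    then show "Z \<in> ?V \<inter> {Z. coord Z k \<noteq> 0}"
      using cline_eq_imp_coord_nonzero by blast
  qed blast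
  moreover have "open {Z. coord Z k \<noteq> 0}"
    by (rule open_Collect_neq[OF linear_continuous_on[OF bounded_linear_coord] continuous_on_const])
  ultimately have "openin (top_of_set ?V) {Z \<in> ?V. cline Z \<in> ?U}"
    by (metis openin_open_Int)
  moreover have "{Z \<in> hom_coords N. coord Z k \<noteq> 0} \<subseteq> ?V" using coord_zero[of k] by auto
  then have "?U \<subseteq> cline ` ?V" by (rule image_mono)
  ultimately show ?thesis by (simp add: openin_proj_topology affine_chart_def)
qed

lemma affine_chart_covers:
  assumes "L \<in> topspace (proj_topology N)"
  obtains k where "affine_chart N k \<in> atlas (proj_space N)" and "L \<in> fst (affine_chart N k)"
proof -
  have "L \<in> cline ` (hom_coords N - {0})"
    using assms openin_topspace[of "proj_topology N"] unfolding openin_proj_topology by blast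
  then obtain Z where Z: "L = cline Z" "Z \<in> hom_coords N" "Z \<noteq> 0" by blast
  then obtain k where k: "coord Z k \<noteq> 0" using ell2_eqI[of Z 0] by (auto simp: coord_zero)
  then have "enat k \<le> N" using Z(2) by (auto simp: hom_coords_def not_less[symmetric])
  with Z k show thesis by (intro that[of k]) (auto simp: proj_space_def affine_chart_def)
qed

text \<open>Here f is \<open>F \<circ> \<iota>\<close> read in one affine chart and d is its complex
  derivative; composing the two pullbacks and inserting the tangent vector 1 expresses the metric of
  the disc through f and d.\<close>

lemma kahler_immersion_on_disc:
  fixes M :: "('m, complex ^ 'n) cmanifold"
  assumes M: "complex_manifold M" and "p \<in> topspace (mtop M)" and "0 < \<rho>"
    and \<iota>: "holomorphic_map (disc_manifold \<rho>) M (disc \<rho>) \<iota>" and "\<iota> 0 = p"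
    and h: "is_pullback (disc_manifold \<rho>) M (disc \<rho>) \<iota> g h"
    and W: "openin (mtop M) W" "p \<in> W"
    and F: "kahler_immersion M g (proj_space N) fubini_study W F"
  obtains \<delta> f d where "0 < \<delta>" and "ball 0 \<delta> \<subseteq> disc \<rho>"
    and "\<And>z. z \<in> ball 0 \<delta> \<Longrightarrow> (f has_derivative (\<lambda>v. v *\<^sub>C d z)) (at z)"
    and "\<And>z. z \<in> ball 0 \<delta> \<Longrightarrow> complex_of_real (h (disc \<rho>, id) z 1 1) =
      cinner (d z) (d z) / (1 + cinner (f z) (f z)) -
      cinner (d z) (f z) * cinner (f z) (d z) / (1 + cinner (f z) (f z))\<^sup>2"
proof -
  have F_hol: "holomorphic_map M (proj_space N) W F"
    and F_pull: "is_pullback M (proj_space N) W F fubini_study g"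
    using F by (auto simp: kahler_immersion_def)
  have F_cont: "continuous_map (subtopology (mtop M) W) (proj_topology N) F"
    using F_hol by (simp add: holomorphic_map_def proj_space_def)
  have \<iota>_cont: "continuous_map (top_of_set (disc \<rho>)) (mtop M) \<iota>"
    using \<iota> by (simp add: holomorphic_map_def disc_manifold_def subtopology_subtopology)
  obtain C where C: "C \<in> atlas M" "p \<in> fst C"
    using M \<open>p \<in> topspace (mtop M)\<close> unfolding complex_manifold_def by blast
  then have C_open: "openin (mtop M) (fst C)" using M by (auto simp: complex_manifold_def)
  have "F p \<in> topspace (proj_topology N)"
    using F_cont \<open>p \<in> W\<close> \<open>p \<in> topspace (mtop M)\<close> by (auto simp: continuous_map_def)
  then obtain k where k: "affine_chart N k \<in> atlas (proj_space N)" "F p \<in> fst (affine_chart N k)"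
    using affine_chart_covers by blast
  define D where "D = affine_chart N k"
  have D: "D \<in> atlas (proj_space N)" "F p \<in> fst D" "openin (proj_topology N) (fst D)"
    using k openin_affine_chart by (auto simp: D_def)
  \<comment> \<open>Where a single chart of \<open>M\<close> and a single affine chart serve at
    once; continuity of F and \<iota> then supplies the radius \<delta>.\<close>
  define V where "V = fst C \<inter> {q \<in> topspace (subtopology (mtop M) W). F q \<in> fst D}"
  have "openin (subtopology (mtop M) W) {q \<in> topspace (subtopology (mtop M) W). F q \<in> fst D}"
    using F_cont D(3) by (rule openin_continuous_map_preimage)
  then have "openin (mtop M) V"
    unfolding V_def using W(1) C_open by (intro openin_Int) (auto simp: openin_open_subtopology)
  then have "openin (top_of_set (disc \<rho>)) {z \<in> topspace (top_of_set (disc \<rho>)). \<iota> z \<in> V}"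
    by (rule openin_continuous_map_preimage[OF \<iota>_cont])
  then have "open {z \<in> disc \<rho>. \<iota> z \<in> V}"
    using openin_open_trans[OF _ open_disc] by auto
  moreover have "0 \<in> {z \<in> disc \<rho>. \<iota> z \<in> V}"
    using \<open>0 < \<rho>\<close> \<open>\<iota> 0 = p\<close> C D W \<open>p \<in> topspace (mtop M)\<close> by (simp add: V_def disc_def zero_ereal_def)
  ultimately obtain \<delta> where "0 < \<delta>" and \<delta>: "ball 0 \<delta> \<subseteq> {z \<in> disc \<rho>. \<iota> z \<in> V}"
    unfolding open_contains_ball by blast
  define f where "f = (\<lambda>z. snd D (F (\<iota> z)))"
  define a where "a = local_rep (disc \<rho>, id) C \<iota>"
  define b where "b = local_rep C D F"
  define d where "d = (\<lambda>z. frechet_derivative f (at z) 1)"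
  have main: "(f has_derivative (\<lambda>v. v *\<^sub>C d z)) (at z) \<and>
      h (disc \<rho>, id) z 1 1 = fubini_study D (F (\<iota> z)) (d z) (d z)"
    if z: "z \<in> ball 0 \<delta>" for z
  proof -
    have in_disc: "y \<in> disc \<rho>" and in_C: "\<iota> y \<in> fst C" and in_W: "\<iota> y \<in> W" and in_D: "F (\<iota> y) \<in> fst D"
      if "y \<in> ball 0 \<delta>" for y
      using \<delta> that by (auto simp: V_def)
    have a_eq: "a y = snd C (\<iota> y)" if "y \<in> ball 0 \<delta>" for y
      using in_disc[OF that] by (simp add: a_def local_rep_def inv_into_id)
    have b_eq: "b (snd C (\<iota> y)) = f y" if "y \<in> ball 0 \<delta>" for y
      using chart_inv_chart[OF M C(1) in_C[OF that]] by (simp add: b_def local_rep_def f_def)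
    have "holo_on (id ` {y \<in> disc \<rho> \<inter> disc \<rho>. \<iota> y \<in> fst C}) a"
      using \<iota> disc_chart_in_atlas[of \<rho>] C(1) unfolding holomorphic_map_def a_def by fastforce
    then obtain Da where Da: "(a has_derivative Da) (at z)" "\<And>c v. Da (c *\<^sub>C v) = c *\<^sub>C Da v"
      using in_disc[OF z] in_C[OF z] unfolding holo_on_def by fastforce
    have "holo_on (snd C ` {q \<in> fst C \<inter> W. F q \<in> fst D}) b"
      using F_hol C(1) D(1) unfolding holomorphic_map_def b_def by blast
    then obtain Db where Db: "(b has_derivative Db) (at (a z))" "\<And>c v. Db (c *\<^sub>C v) = c *\<^sub>C Db v"
      using in_C[OF z] in_W[OF z] in_D[OF z] unfolding holo_on_def a_eq[OF z] by blast
    have "((\<lambda>y. b (a y)) has_derivative (\<lambda>v. Db (Da v))) (at z)"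
      by (rule has_derivative_compose[OF Da(1) Db(1)])
    then have f: "(f has_derivative (\<lambda>v. Db (Da v))) (at z)"
      by (rule has_derivative_transform_within_open[OF _ open_ball z]) (simp add: a_eq b_eq)
    then have d: "d z = Db (Da 1)" by (simp add: d_def frechet_derivative_at[symmetric])
    have "Db (Da v) = v *\<^sub>C d z" for v
      using Da(2)[of v 1] Db(2) by (simp add: d scaleC_complex_def)
    then have "(f has_derivative (\<lambda>v. v *\<^sub>C d z)) (at z)" using f by simp
    moreover have "h (disc \<rho>, id) z 1 1 = g C (\<iota> z) (Da 1) (Da 1)"
      using h disc_chart_in_atlas[of \<rho>] C(1) in_disc[OF z] in_C[OF z]
        frechet_derivative_at[OF Da(1)]
      unfolding is_pullback_def a_def by fastforce
    moreover have "g C (\<iota> z) (Da 1) (Da 1) = fubini_study D (F (\<iota> z)) (d z) (d z)"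
      using F_pull C(1) D(1) in_C[OF z] in_W[OF z] in_D[OF z]
        frechet_derivative_at[OF Db(1)]
      unfolding is_pullback_def b_def d a_eq[OF z] by fastforce
    ultimately show ?thesis by simp
  qed
  show thesis
  proof
    show "0 < \<delta>" "ball 0 \<delta> \<subseteq> disc \<rho>" using \<open>0 < \<delta>\<close> \<delta> by auto
    fix z :: complex assume "z \<in> ball 0 \<delta>"
    from main[OF this] show "(f has_derivative (\<lambda>v. v *\<^sub>C d z)) (at z)"
      "complex_of_real (h (disc \<rho>, id) z 1 1) =
        cinner (d z) (d z) / (1 + cinner (f z) (f z)) -
        cinner (d z) (f z) * cinner (f z) (d z) / (1 + cinner (f z) (f z))\<^sup>2"
      by (simp_all add: fubini_study_self f_def)
  qed
qed

lemma radial_potential_metric: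
  assumes "kahler_potential (disc_manifold \<rho>) h (\<lambda>z. \<phi> ((cmod z)\<^sup>2))"
    and "open S" and "p holomorphic_on S"
    and S: "\<And>z. z \<in> disc \<rho> \<Longrightarrow> z * cnj z \<in> S"
    and p: "\<And>z. z \<in> disc \<rho> \<Longrightarrow> p (z * cnj z) = complex_of_real (\<phi> ((cmod z)\<^sup>2))"
    and z: "z \<in> disc \<rho>"
  shows "complex_of_real (h (disc \<rho>, id) z 1 1) =
    deriv p (z * cnj z) + z * cnj z * deriv (deriv p) (z * cnj z)"
proof -
  define \<Phi> where "\<Phi> = (\<lambda>z. \<phi> ((cmod z)\<^sup>2)) \<circ> chart_inv (disc \<rho>, id)"
  \<comment> \<open>\<open>kahler_form\<close> multiplies its first argument by i, so the argument
    -i recovers h(1, 1); on this pair u cnj v - v cnj u is -2 i, which the factor i/2 turns into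
    1.\<close>
  have "complex_of_real (kahler_form h (disc \<rho>, id) z (- \<i>) 1) = \<i> / 2 * ddbar \<Phi> z (- \<i>) 1"
    using assms(1) disc_chart_in_atlas[of \<rho>] z unfolding kahler_potential_def \<Phi>_def by fastforce
  also have "ddbar \<Phi> z (- \<i>) 1 =
      (deriv p (z * cnj z) + z * cnj z * deriv (deriv p) (z * cnj z)) * (- \<i> * cnj 1 - 1 * cnj (- \<i>))"
    using assms(2,3) open_disc z S
    by (rule ddbar_radial) (simp_all add: \<Phi>_def inv_into_id p)
  also have "\<i> / 2 * (c * (- \<i> * cnj 1 - 1 * cnj (- \<i>))) = c" for c
    by (simp add: complex_eq_iff)
  also have "kahler_form h (disc \<rho>, id) z (- \<i>) 1 = h (disc \<rho>, id) z 1 1"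
    unfolding kahler_form_def scaleC_complex_def by simp
  finally show ?thesis .
qed

theorem theorem2:
  fixes M :: "('m, complex ^ 'n) cmanifold"
    and g :: "('m, complex ^ 'n) metric"
    and p :: 'm
    and \<rho> :: ereal
    and \<iota> :: "complex \<Rightarrow> 'm"
    and h :: "(complex, complex) metric"
    and \<phi> :: "real \<Rightarrow> real"
    and \<phi>ext :: "complex \<Rightarrow> complex"
    and S :: "complex set"
  assumes "kahler_manifold M g"
    and "p \<in> topspace (mtop M)"
    and "0 < \<rho>"
    and "holomorphic_embedding (disc_manifold \<rho>) M \<iota>"
    and "\<iota> 0 = p"
    and "is_pullback (disc_manifold \<rho>) M (disc \<rho>) \<iota> g h"
    and "kahler_potential (disc_manifold \<rho>) h (\<lambda>z. \<phi> ((cmod z)\<^sup>2))"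
    and "\<phi> 0 = 0"
    and "open S"
    and "complex_of_real ` {x. 0 \<le> x \<and> ereal x < \<rho>} \<subseteq> S"
    and "\<phi>ext holomorphic_on S"
    and "\<And>x. 0 \<le> x \<Longrightarrow> ereal x < \<rho> \<Longrightarrow> \<phi>ext (complex_of_real x) = complex_of_real (\<phi> x)"
    and "fps_conv_radius (fps_expansion (\<lambda>X. exp (\<phi>ext X)) 0) < \<rho>"
  shows "(\<forall>W. openin (mtop M) W \<and> p \<in> W \<longrightarrow>
           (\<forall>N. \<not> (\<exists>F. kahler_immersion M g (proj_space N) fubini_study W F)))
         \<and> \<not> projectively_induced M g"
proof -
  have "\<not> kahler_immersion M g (proj_space N) fubini_study W F"
    if W: "openin (mtop M) W" "p \<in> W" for W N F
  proof
    assume F: "kahler_immersion M g (proj_space N) fubini_study W F"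
    define E where "E = (\<lambda>X. exp (\<phi>ext X))"
    define e where "e = fps_expansion E 0"
    have "complex_manifold M" using assms(1) by (simp add: kahler_manifold_def)
    moreover have "holomorphic_map (disc_manifold \<rho>) M (disc \<rho>) \<iota>"
      using assms(4) by (simp add: holomorphic_embedding_def topspace_disc_manifold)
    ultimately obtain \<delta> f d where \<delta>: "0 < \<delta>" "ball 0 \<delta> \<subseteq> disc \<rho>"
      and f: "\<And>z. z \<in> ball 0 \<delta> \<Longrightarrow> (f has_derivative (\<lambda>v. v *\<^sub>C d z)) (at z)"
      and h: "\<And>z. z \<in> ball 0 \<delta> \<Longrightarrow> complex_of_real (h (disc \<rho>, id) z 1 1) =
        cinner (d z) (d z) / (1 + cinner (f z) (f z)) -
        cinner (d z) (f z) * cinner (f z) (d z) / (1 + cinner (f z) (f z))\<^sup>2"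
      using kahler_immersion_on_disc[OF _ assms(2,3) _ assms(5,6) W F] by metis
    have S: "z * cnj z \<in> S"
      and ext: "\<phi>ext (z * cnj z) = complex_of_real (\<phi> ((cmod z)\<^sup>2))" if "z \<in> disc \<rho>" for z :: complex
      using that assms(10) assms(12)[of "(cmod z)\<^sup>2"]
      by (auto simp: disc_def complex_norm_square[symmetric] simp del: of_real_power)
    have S': "z * cnj z \<in> S" if "z \<in> ball 0 \<delta>" for z :: complex using S \<delta>(2) that by blast
    have "0 \<in> S" using assms(3,10) by (force simp: zero_ereal_def)
    have E: "E holomorphic_on S" unfolding E_def using assms(11) by (intro holomorphic_intros)
    then have expansion: "E has_fps_expansion e"
      unfolding e_def using \<open>open S\<close> \<open>0 \<in> S\<close> by (intro has_fps_expansion_fps_expansion)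
    have nonneg: "fps_nth e n \<in> \<real>\<^sub>\<ge>\<^sub>0" for n
    proof (rule exp_radial_eq_sum_of_squares[OF \<open>open S\<close> assms(11) refl \<delta>(1) S'])
      fix z :: complex assume z: "z \<in> ball 0 \<delta>"
      then have "z \<in> disc \<rho>" using \<delta> by blast
      then show "\<phi>ext (z * cnj z) \<in> \<real>" by (simp add: ext)
      show "(f has_derivative (\<lambda>v. v *\<^sub>C d z)) (at z)" by (rule f[OF z])
      show "deriv \<phi>ext (z * cnj z) + z * cnj z * deriv (deriv \<phi>ext) (z * cnj z) =
        cinner (d z) (d z) / (1 + cinner (f z) (f z)) -
        cinner (d z) (f z) * cinner (f z) (d z) / (1 + cinner (f z) (f z))\<^sup>2"
        using radial_potential_metric[OF assms(7,9,11) S ext \<open>z \<in> disc \<rho>\<close>] h[OF z] by simp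
    next
      fix G F1 F1'
      assume G: "G holomorphic_on ball 0 \<delta>"
        and F1: "\<And>z. z \<in> ball 0 \<delta> \<Longrightarrow> (F1 has_derivative (\<lambda>v. v *\<^sub>C F1' z)) (at z)"
        and eq: "\<And>z. z \<in> ball 0 \<delta> \<Longrightarrow>
          exp (\<phi>ext (z * cnj z)) = G z * cnj (G z) + cinner (F1 z) (F1 z)"
      show "fps_nth e n \<in> \<real>\<^sub>\<ge>\<^sub>0"
        by (rule fps_nth_nonneg_of_sum_of_squares[OF expansion E \<open>open S\<close> open_ball _ S' G F1])
          (use \<delta>(1) eq in \<open>simp_all add: E_def\<close>)
    qed
    have radius: "fps_conv_radius e < \<rho>" using assms(13) by (simp add: e_def E_def)
    moreover have "0 < fps_conv_radius e" using expansion by (simp add: has_fps_expansion_def)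
    ultimately obtain r where r: "fps_conv_radius e = ereal r"
      by (cases "fps_conv_radius e") auto
    \<comment> \<open>The strict inequality r < \<rho> is what puts the endpoint r, the singularity
      predicted by Pringsheim, inside the domain of analyticity.\<close>
    have "complex_of_real ` {0..r} \<subseteq> S"
    proof -
      have "{0..r} \<subseteq> {x. 0 \<le> x \<and> ereal x < \<rho>}"
        using radius unfolding r by (auto intro: le_less_trans[of _ "ereal r"])
      then show ?thesis using assms(10) by blast
    qed
    from pringsheim[OF expansion nonneg \<open>open S\<close> this E] r show False by blast
  qed
  \<comment> \<open>A global immersion is the case where \<open>W\<close> is the whole
    space.\<close>
  then show ?thesis
    using assms(2) openin_topspace unfolding projectively_induced_def by blast
qed

end
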